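(* Let $\mathcal{M}=\{\mathbf{M}^{(\lambda)}:\lambda>0\}$ and $\mathcal{N}=\{\mathbf{N}^{(\lambda)}:\lambda>0\}$ be weight matrices (of sequences indexed by $\mathbb{N}_0^d$) and consider the following assertions: (i) $\mathcal{M}\vartriangleleft\mathcal{N}$; (ii) $\mathcal{S}_{\{\mathcal{M}\}}(\mathbb{R}^d)\subseteq\mathcal{S}_{(\mathcal{N})}(\mathbb{R}^d)$ holds with continuous inclusion. Then (i)$\Rightarrow$(ii) is valid for all dimensions $d\in\mathbb{N}$, and the classes in (ii) can be defined by joint or separated growth at infinity. If (ii) holds for the case $d=1$, both matrices are standard log-convex, $\mathcal{M}$ satisfies (R1) and (R2), and $\mathcal{N}$ satisfies (B1) and (B2), then (ii)$\Rightarrow$(i) is valid, too. Here (R1) $\forall\lambda>0\ \exists\kappa\ge\lambda,\ B,C,H>0\ \forall\alpha,\beta\in\mathbb{N}_0^d:\ \alpha^{\alpha/2}M^{(\lambda)}_\beta\le BC^{|\alpha|}H^{|\alpha+\beta|}M^{(\kappa)}_{\alpha+\beta}$; (R2) $\forall\lambda>0\ \exists\kappa\ge\lambda,\ A\ge 1\ \forall\alpha\in\mathbb{N}_0^d,\ 1\le j\le d:\ M^{(\lambda)}_{\alpha+e_j}\le A^{|\alpha|+1}M^{(\kappa)}_\alpha$; (B1) $\forall\lambda>0\ \exists\,0<\kappa\le\lambda,\ H>0\ \forall C>0\ \exists B>0\ \forall\alpha,\beta\in\mathbb{N}_0^d:\ \alpha^{\alpha/2}N^{(\kappa)}_\beta\le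 BC^{|\alpha|}H^{|\alpha+\beta|}N^{(\lambda)}_{\alpha+\beta}$; (B2) $\forall\lambda>0\ \exists\,0<\kappa\le\lambda,\ A\ge 1\ \forall\alpha\in\mathbb{N}_0^d,\ 1\le j\le d:\ N^{(\kappa)}_{\alpha+e_j}\le A^{|\alpha|+1}N^{(\lambda)}_\alpha$.
   Context: $\mathbb{N}_0=\mathbb{N}\cup\{0\}$; $\alpha^{\alpha/2}=\prod_j\alpha_j^{\alpha_j/2}$ with $0^0=1$; $e_j$ is the $j$-th unit vector. A weight matrix is a family $\mathcal{M}=(\mathbf{M}^{(\lambda)})_{\lambda>0}$ of sequences $\mathbf{M}^{(\lambda)}=(M^{(\lambda)}_\alpha)_{\alpha\in\mathbb{N}_0^d}$ of positive reals with $M^{(\lambda)}_0=1$ and $M^{(\lambda)}_\alpha\le M^{(\kappa)}_\alpha$ for all $\alpha$ whenever $0<\lambda\le\kappa$. For $d=1$ it is standard log-convex if each $\mathbf{M}^{(\lambda)}\in\mathcal{LC}$, where $\mathcal{LC}$ is the set of positive sequences $(M_p)_{p\in\mathbb{N}_0}$ with $M_1\ge M_0=1$, $M_p^2\le M_{p-1}M_{p+1}$ for $p\ge 1$, and $\lim_{p\to\infty}(M_p)^{1/p}=\infty$. $\mathbf{M}\vartriangleleft\mathbf{N}$ means $\lim_{|\alpha|\to\infty}(M_\alpha/N_\alpha)^{1/|\alpha|}=0$. $\mathcal{M}\vartriangleleft\mathcal{N}$ means: $\forall\lambda>0\ \forall\kappa>0:\ \mathbf{M}^{(\lambda)}\vartriangleleft\mathbf{N}^{(\kappa)}$.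 For $f\in C^\infty(\mathbb{R}^d)$ and $h>0$ put $\|f\|_{\infty,\mathbf{M},h}:=\sup_{\alpha,\beta\in\mathbb{N}_0^d}\frac{\|x^\alpha\partial^\beta f\|_\infty}{h^{|\alpha+\beta|}M_{\alpha+\beta}}$ ($\|\cdot\|_\infty$ is the supremum norm on $\mathbb{R}^d$). $\mathcal{S}_{\{\mathcal{M}\}}(\mathbb{R}^d)$ is the space of all $f\in C^\infty(\mathbb{R}^d)$ with $\|f\|_{\infty,\mathbf{M}^{(\lambda)},h}<\infty$ for some $\lambda,h>0$ (inductive limit topology); $\mathcal{S}_{(\mathcal{M})}(\mathbb{R}^d)$ is the space of all $f\in C^\infty(\mathbb{R}^d)$ with $\|f\|_{\infty,\mathbf{M}^{(\lambda)},h}<\infty$ for all $\lambda,h>0$ (projective limit topology). These are the definitions by joint growth at infinity; in the definitions by separated growth at infinity, $M^{(\lambda)}_{\alpha+\beta}$ is replaced by $M^{(\lambda)}_\alpha M^{(\lambda)}_\beta$ in the seminorms. *)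

theory Defs
  imports "HOL-Analysis.Analysis"
begin

section \<open>Multi-indices and iterated partial derivatives\<close>

text \<open>A multi-index in \<open>\<nat>\<^sub>0\<^sup>d\<close> is an element of \<^typ>\<open>nat ^ 'n\<close> with \<open>d = CARD('n)\<close>; the unit
  vector \<open>e\<^sub>j\<close> is \<^term>\<open>axis j (1::nat)\<close>.\<close>

definition mi_size :: "nat ^ 'n::finite \<Rightarrow> nat" where
  "mi_size \<alpha> = (\<Sum>i\<in>UNIV. \<alpha> $ i)"

definition mi_monom :: "real ^ 'n::finite \<Rightarrow> nat ^ 'n \<Rightarrow> real" where
  "mi_monom x \<alpha> = (\<Prod>i\<in>UNIV. (x $ i) ^ (\<alpha> $ i))"

text \<open>The quantity \<open>\<alpha>\<^bsup>\<alpha>/2\<^esup>\<close>. Written with \<^const>\<open>sqrt\<close> because \<open>0 powr 0 = 0\<close> in HOL, whereas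
  \<open>0 ^ 0 = 1\<close>.\<close>

definition mi_half_power :: "nat ^ 'n::finite \<Rightarrow> real" where
  "mi_half_power \<alpha> = (\<Prod>i\<in>UNIV. sqrt (real (\<alpha> $ i) ^ (\<alpha> $ i)))"

definition partial_deriv :: "'n::finite \<Rightarrow> (real ^ 'n \<Rightarrow> complex) \<Rightarrow> real ^ 'n \<Rightarrow> complex" where
  "partial_deriv i f x = vector_derivative (\<lambda>t. f (x + t *\<^sub>R axis i 1)) (at 0)"

definition has_partial_deriv_at :: "'n::finite \<Rightarrow> (real ^ 'n \<Rightarrow> complex) \<Rightarrow> real ^ 'n \<Rightarrow> bool" where
  "has_partial_deriv_at i f x \<longleftrightarrow> (\<lambda>t. f (x + t *\<^sub>R axis i 1)) differentiable (at (0::real))"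

fun iter_partial :: "'n::finite list \<Rightarrow> (real ^ 'n \<Rightarrow> complex) \<Rightarrow> real ^ 'n \<Rightarrow> complex" where
  "iter_partial [] f = f"
| "iter_partial (i # is) f = partial_deriv i (iter_partial is f)"

definition C_infinity :: "(real ^ 'n::finite \<Rightarrow> complex) set" where
  "C_infinity = {f. \<forall>is. continuous_on UNIV (iter_partial is f) \<and>
                        (\<forall>i x. has_partial_deriv_at i (iter_partial is f) x)}"

text \<open>\<open>\<partial>\<^sup>\<beta> f\<close>: differentiate \<open>\<beta>\<^sub>i\<close> times in direction \<open>i\<close>, for every \<open>i\<close>. The type \<^typ>\<open>'n\<close> carries no
  order, so the order of differentiation is chosen arbitrarily; for \<open>f\<close> in \<^const>\<open>C_infinity\<close>
  the result does not depend on it.\<close>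

definition mi_deriv :: "nat ^ 'n::finite \<Rightarrow> (real ^ 'n \<Rightarrow> complex) \<Rightarrow> real ^ 'n \<Rightarrow> complex" where
  "mi_deriv \<beta> = iter_partial (SOME is. \<forall>i. count_list is i = \<beta> $ i)"


section \<open>Locally convex topologies on spaces of complex-valued functions\<close>

definition seminorm_on :: "('a \<Rightarrow> complex) set \<Rightarrow> (('a \<Rightarrow> complex) \<Rightarrow> real) \<Rightarrow> bool" where
  "seminorm_on V p \<longleftrightarrow>
     (\<forall>f\<in>V. 0 \<le> p f) \<and>
     (\<forall>f\<in>V. \<forall>g\<in>V. p (\<lambda>x. f x + g x) \<le> p f + p g) \<and>
     (\<forall>f\<in>V. \<forall>c. p (\<lambda>x. c * f x) = cmod c * p f)"

text \<open>The topology on \<open>V\<close> generated by a family \<open>P\<close> of seminorms; \<open>V\<close> itself is put into the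
  subbase so that the topology lives on \<open>V\<close> also for empty \<open>P\<close>.\<close>

definition seminorm_topology ::
    "('a \<Rightarrow> complex) set \<Rightarrow> (('a \<Rightarrow> complex) \<Rightarrow> real) set \<Rightarrow> ('a \<Rightarrow> complex) topology" where
  "seminorm_topology V P = topology_generated_by
     (insert V {{f \<in> V. p (\<lambda>x. f x - g x) < r} | p g r. p \<in> P \<and> g \<in> V \<and> 0 < r})"

definition locally_convex_topology_on ::
    "('a \<Rightarrow> complex) set \<Rightarrow> ('a \<Rightarrow> complex) topology \<Rightarrow> bool" where
  "locally_convex_topology_on V T \<longleftrightarrow>
     (\<exists>P. (\<forall>p\<in>P. seminorm_on V p) \<and> T = seminorm_topology V P)"

text \<open>The locally convex inductive limit: the finest locally convex topology on the union of the
  steps for which all inclusions of the steps are continuous, that is, the supremum of all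
  locally convex topologies with this property. The supremum has the property as well, see
  \<open>lc_inductive_limit_locally_convex\<close> and \<open>lc_inductive_limit_step\<close> below.\<close>

definition lc_inductive_limit ::
    "'i set \<Rightarrow> ('i \<Rightarrow> ('a \<Rightarrow> complex) topology) \<Rightarrow> ('a \<Rightarrow> complex) topology" where
  "lc_inductive_limit I X = topology_generated_by
     {U. \<exists>T. locally_convex_topology_on (\<Union>i\<in>I. topspace (X i)) T \<and>
             (\<forall>i\<in>I. continuous_map (X i) T (\<lambda>f. f)) \<and> openin T U}"

text \<open>The projective limit: the coarsest topology on the intersection of the steps for which all
  inclusions into the steps are continuous.\<close>

definition projective_limit ::
    "'i set \<Rightarrow> ('i \<Rightarrow> ('a \<Rightarrow> complex) topology) \<Rightarrow> ('a \<Rightarrow> complex) topology" where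
  "projective_limit I X = topology_generated_by
     {(\<Inter>j\<in>I. topspace (X j)) \<inter> U | i U. i \<in> I \<and> openin (X i) U}"

lemma topspace_seminorm_topology [simp]: "topspace (seminorm_topology V P) = V"
  unfolding seminorm_topology_def topology_generated_by_topspace by auto

lemma openin_seminorm_topology_ball:
  assumes "p \<in> P" "g \<in> V" "0 < r"
  shows "openin (seminorm_topology V P) {f \<in> V. p (\<lambda>x. f x - g x) < r}"
  unfolding seminorm_topology_def
  by (intro topology_generated_by_Basis insertI2 CollectI exI conjI) (use assms in auto)

lemma openin_seminorm_topology_least:
  assumes "openin (seminorm_topology V P) U" and "openin T V"
    and "\<And>p g r. \<lbrakk>p \<in> P; g \<in> V; 0 < r\<rbrakk> \<Longrightarrow> openin T {f \<in> V. p (\<lambda>x. f x - g x) < r}"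
  shows "openin T U"
proof -
  have "generate_topology_on
      (insert V {{f \<in> V. p (\<lambda>x. f x - g x) < r} | p g r. p \<in> P \<and> g \<in> V \<and> 0 < r}) U"
    using assms(1) by (simp add: seminorm_topology_def openin_topology_generated_by_iff)
  then show ?thesis
  proof induction
    case (Basis s)
    then show ?case using assms(2,3) by (elim insertE CollectE exE conjE) simp_all
  qed auto
qed

lemma locally_convex_topology_on_topspace:
  "locally_convex_topology_on V T \<Longrightarrow> topspace T = V"
  unfolding locally_convex_topology_on_def by auto

lemma topspace_lc_inductive_limit:
  "topspace (lc_inductive_limit I X) = (\<Union>i\<in>I. topspace (X i))" (is "_ = ?V")
proof
  show "topspace (lc_inductive_limit I X) \<subseteq> ?V"
    unfolding lc_inductive_limit_def topology_generated_by_topspace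
    by (intro Union_least, elim CollectE exE conjE)
      (metis locally_convex_topology_on_topspace openin_subset)
  have triv: "U = {} \<or> U = ?V" if "openin (seminorm_topology ?V {}) U" for U
  proof -
    have "generate_topology_on {?V} U"
      using that by (simp add: seminorm_topology_def openin_topology_generated_by_iff)
    then show "U = {} \<or> U = ?V"
      by induction auto
  qed
  have "continuous_map (X i) (seminorm_topology ?V {}) (\<lambda>f. f)" if "i \<in> I" for i
  proof -
    have full: "{x \<in> topspace (X i). x \<in> ?V} = topspace (X i)"
      using that by blast
    have "openin (X i) {x \<in> topspace (X i). x \<in> U}" if "openin (seminorm_topology ?V {}) U" for U
      using triv [OF that] full by (elim disjE) simp_all
    moreover have "topspace (X i) \<subseteq> ?V"
      using that by blast
    ultimately show ?thesis
      unfolding continuous_map_def Pi_iff topspace_seminorm_topology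
      by (simp, use that in blast)
  qed
  moreover have "locally_convex_topology_on ?V (seminorm_topology ?V {})"
    unfolding locally_convex_topology_on_def by (intro exI [of _ "{}"]) simp
  moreover have "openin (seminorm_topology ?V {}) ?V"
    by (metis openin_topspace topspace_seminorm_topology)
  ultimately show "?V \<subseteq> topspace (lc_inductive_limit I X)"
    unfolding lc_inductive_limit_def topology_generated_by_topspace
    by (intro Union_upper CollectI exI [of _ "seminorm_topology ?V {}"] conjI ballI)
qed

lemma lc_inductive_limit_step:
  assumes "i \<in> I"
  shows "continuous_map (X i) (lc_inductive_limit I X) (\<lambda>f. f)"
  unfolding lc_inductive_limit_def
proof (rule continuous_on_generated_topo)
  fix U assume "U \<in> {U. \<exists>T. locally_convex_topology_on (\<Union>i\<in>I. topspace (X i)) T \<and>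
             (\<forall>i\<in>I. continuous_map (X i) T (\<lambda>f. f)) \<and> openin T U}"
  then obtain T where "continuous_map (X i) T (\<lambda>f. f)" "openin T U"
    using assms by (elim CollectE exE conjE) metis
  then show "openin (X i) ((\<lambda>f. f) -` U \<inter> topspace (X i))"
    using openin_continuous_map_preimage [of "X i" T "\<lambda>f. f" U]
    by (simp add: vimage_def Int_def conj_commute)
next
  show "(\<lambda>f. f) ` topspace (X i) \<subseteq> \<Union> {U. \<exists>T. locally_convex_topology_on (\<Union>i\<in>I. topspace (X i)) T \<and>
             (\<forall>i\<in>I. continuous_map (X i) T (\<lambda>f. f)) \<and> openin T U}"
    using topspace_lc_inductive_limit [of I X] assms
    unfolding lc_inductive_limit_def topology_generated_by_topspace by auto
qed

lemma lc_inductive_limit_finest: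
  assumes "locally_convex_topology_on (\<Union>i\<in>I. topspace (X i)) T"
    and "\<And>i. i \<in> I \<Longrightarrow> continuous_map (X i) T (\<lambda>f. f)" and "openin T U"
  shows "openin (lc_inductive_limit I X) U"
  unfolding lc_inductive_limit_def
  by (rule topology_generated_by_Basis, intro CollectI exI [of _ T] conjI ballI) (fact assms)+

lemma lc_inductive_limit_locally_convex:
  "locally_convex_topology_on (\<Union>i\<in>I. topspace (X i)) (lc_inductive_limit I X)"
proof -
  let ?V = "\<Union>i\<in>I. topspace (X i)"
  define PP where "PP = {P. (\<forall>p\<in>P. seminorm_on ?V p) \<and>
    (\<forall>i\<in>I. continuous_map (X i) (seminorm_topology ?V P) (\<lambda>f. f))}"
  have "lc_inductive_limit I X = seminorm_topology ?V (\<Union>PP)"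
  proof (rule topology_eq [THEN iffD2], intro allI iffI)
    fix U assume "openin (lc_inductive_limit I X) U"
    then have "generate_topology_on {U. \<exists>T. locally_convex_topology_on ?V T \<and>
             (\<forall>i\<in>I. continuous_map (X i) T (\<lambda>f. f)) \<and> openin T U} U"
      by (simp add: lc_inductive_limit_def openin_topology_generated_by_iff)
    then show "openin (seminorm_topology ?V (\<Union>PP)) U"
    proof induction
      case (Basis s)
      then obtain T where T: "locally_convex_topology_on ?V T"
        "\<forall>i\<in>I. continuous_map (X i) T (\<lambda>f. f)" "openin T s"
        by (elim CollectE exE conjE) simp
      from T(1) obtain P where sn: "\<forall>p\<in>P. seminorm_on ?V p" and TP: "T = seminorm_topology ?V P"
        unfolding locally_convex_topology_on_def by (elim exE conjE) simp
      have P: "P \<in> PP" "openin (seminorm_topology ?V P) s"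
        using T(2,3) sn unfolding TP PP_def by simp_all
      show ?case
        using P(2)
      proof (rule openin_seminorm_topology_least)
        show "openin (seminorm_topology ?V (\<Union>PP)) ?V"
          by (metis openin_topspace topspace_seminorm_topology)
        show "openin (seminorm_topology ?V (\<Union>PP)) {f \<in> ?V. p (\<lambda>x. f x - g x) < r}"
          if "p \<in> P" "g \<in> ?V" "0 < r" for p g and r :: real
          using UnionI [OF P(1) that(1)] that(2,3) by (rule openin_seminorm_topology_ball)
      qed
    qed (simp_all add: openin_Int openin_Union)
  next
    fix U assume "openin (seminorm_topology ?V (\<Union>PP)) U"
    then show "openin (lc_inductive_limit I X) U"
    proof (rule openin_seminorm_topology_least)
      show "openin (lc_inductive_limit I X) ?V"
        by (metis openin_topspace topspace_lc_inductive_limit)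
    next
      fix p g and r :: real assume pgr: "p \<in> \<Union>PP" "g \<in> ?V" "0 < r"
      then obtain P where P: "P \<in> PP" "p \<in> P" by blast
      have "\<forall>p\<in>P. seminorm_on ?V p"
        using P(1) by (simp add: PP_def)
      then have "locally_convex_topology_on ?V (seminorm_topology ?V P)"
        unfolding locally_convex_topology_on_def by (intro exI [of _ P] conjI refl)
      then show "openin (lc_inductive_limit I X) {f \<in> ?V. p (\<lambda>x. f x - g x) < r}"
      proof (rule lc_inductive_limit_finest)
        show "continuous_map (X i) (seminorm_topology ?V P) (\<lambda>f. f)" if "i \<in> I" for i
          using P(1) that by (simp add: PP_def)
        show "openin (seminorm_topology ?V P) {f \<in> ?V. p (\<lambda>x. f x - g x) < r}"
          using P(2) pgr(2,3) by (rule openin_seminorm_topology_ball)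
      qed
    qed
  qed
  moreover have "\<forall>p\<in>\<Union>PP. seminorm_on ?V p"
    unfolding PP_def by (intro ballI) (elim UnionE CollectE conjE, simp)
  ultimately show ?thesis
    unfolding locally_convex_topology_on_def by (intro exI [of _ "\<Union>PP"] conjI)
qed

lemma topspace_projective_limit:
  assumes "I \<noteq> {}"
  shows "topspace (projective_limit I X) = (\<Inter>i\<in>I. topspace (X i))" (is "_ = ?V")
proof
  show "topspace (projective_limit I X) \<subseteq> ?V"
    unfolding projective_limit_def topology_generated_by_topspace
    by (intro Union_least, elim CollectE exE conjE) simp
  obtain i where i: "i \<in> I" using assms by blast
  then have "?V = ?V \<inter> topspace (X i)" by blast
  then have "?V \<in> {?V \<inter> U | i U. i \<in> I \<and> openin (X i) U}"
    using i openin_topspace by (intro CollectI exI [of _ i] exI [of _ "topspace (X i)"] conjI)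
  then show "?V \<subseteq> topspace (projective_limit I X)"
    unfolding projective_limit_def topology_generated_by_topspace by (rule Union_upper)
qed


section \<open>Weight matrices\<close>

text \<open>A weight matrix is a function on \<^typ>\<open>real\<close>; only its values at positive parameters matter.\<close>

definition weight_matrix :: "(real \<Rightarrow> nat ^ 'n::finite \<Rightarrow> real) \<Rightarrow> bool" where
  "weight_matrix M \<longleftrightarrow>
     (\<forall>l>0. (\<forall>\<alpha>. 0 < M l \<alpha>) \<and> M l 0 = 1) \<and>
     (\<forall>l k. 0 < l \<and> l \<le> k \<longrightarrow> (\<forall>\<alpha>. M l \<alpha> \<le> M k \<alpha>))"

definition log_convex_class :: "(nat \<Rightarrow> real) set" where
  "log_convex_class = {M. (\<forall>p. 0 < M p) \<and> M 0 = 1 \<and> 1 \<le> M 1 \<and>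
     (\<forall>p\<ge>1. (M p)\<^sup>2 \<le> M (p - 1) * M (p + 1)) \<and>
     filterlim (\<lambda>p. root p (M p)) at_top sequentially}"

text \<open>Only meant for \<open>CARD('n) = 1\<close>, where \<open>p \<mapsto> (\<chi> i. p)\<close> identifies \<open>\<nat>\<^sub>0\<close> with the multi-indices.\<close>

definition standard_log_convex :: "(real \<Rightarrow> nat ^ 'n::finite \<Rightarrow> real) \<Rightarrow> bool" where
  "standard_log_convex M \<longleftrightarrow> (\<forall>l>0. (\<lambda>p. M l (\<chi> i. p)) \<in> log_convex_class)"

definition seq_strictly_below :: "(nat ^ 'n::finite \<Rightarrow> real) \<Rightarrow> (nat ^ 'n \<Rightarrow> real) \<Rightarrow> bool" where
  "seq_strictly_below M N \<longleftrightarrow>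
     ((\<lambda>\<alpha>. root (mi_size \<alpha>) (M \<alpha> / N \<alpha>)) \<longlongrightarrow> 0) (filtercomap mi_size at_top)"

definition matrix_strictly_below ::
    "(real \<Rightarrow> nat ^ 'n::finite \<Rightarrow> real) \<Rightarrow> (real \<Rightarrow> nat ^ 'n \<Rightarrow> real) \<Rightarrow> bool" where
  "matrix_strictly_below M N \<longleftrightarrow> (\<forall>l>0. \<forall>k>0. seq_strictly_below (M l) (N k))"

definition cond_R1 :: "(real \<Rightarrow> nat ^ 'n::finite \<Rightarrow> real) \<Rightarrow> bool" where
  "cond_R1 M \<longleftrightarrow> (\<forall>l>0. \<exists>k\<ge>l. \<exists>B>0. \<exists>C>0. \<exists>H>0. \<forall>\<alpha> \<beta>.
     mi_half_power \<alpha> * M l \<beta> \<le> B * C ^ mi_size \<alpha> * H ^ mi_size (\<alpha> + \<beta>) * M k (\<alpha> + \<beta>))"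

definition cond_R2 :: "(real \<Rightarrow> nat ^ 'n::finite \<Rightarrow> real) \<Rightarrow> bool" where
  "cond_R2 M \<longleftrightarrow> (\<forall>l>0. \<exists>k\<ge>l. \<exists>A\<ge>1. \<forall>\<alpha> j.
     M l (\<alpha> + axis j 1) \<le> A ^ (mi_size \<alpha> + 1) * M k \<alpha>)"

definition cond_B1 :: "(real \<Rightarrow> nat ^ 'n::finite \<Rightarrow> real) \<Rightarrow> bool" where
  "cond_B1 N \<longleftrightarrow> (\<forall>l>0. \<exists>k. 0 < k \<and> k \<le> l \<and> (\<exists>H>0. \<forall>C>0. \<exists>B>0. \<forall>\<alpha> \<beta>.
     mi_half_power \<alpha> * N k \<beta> \<le> B * C ^ mi_size \<alpha> * H ^ mi_size (\<alpha> + \<beta>) * N l (\<alpha> + \<beta>)))"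

definition cond_B2 :: "(real \<Rightarrow> nat ^ 'n::finite \<Rightarrow> real) \<Rightarrow> bool" where
  "cond_B2 N \<longleftrightarrow> (\<forall>l>0. \<exists>k. 0 < k \<and> k \<le> l \<and> (\<exists>A\<ge>1. \<forall>\<alpha> j.
     N k (\<alpha> + axis j 1) \<le> A ^ (mi_size \<alpha> + 1) * N l \<alpha>))"


section \<open>Gelfand--Shilov type classes\<close>

text \<open>How a weight sequence enters the seminorms: joint or separated growth at infinity.\<close>

definition joint_growth :: "(nat ^ 'n::finite \<Rightarrow> real) \<Rightarrow> nat ^ 'n \<Rightarrow> nat ^ 'n \<Rightarrow> real" where
  "joint_growth M \<alpha> \<beta> = M (\<alpha> + \<beta>)"

definition separated_growth :: "(nat ^ 'n::finite \<Rightarrow> real) \<Rightarrow> nat ^ 'n \<Rightarrow> nat ^ 'n \<Rightarrow> real" where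
  "separated_growth M \<alpha> \<beta> = M \<alpha> * M \<beta>"

text \<open>The weighted norm, with values in \<open>[0, \<infinity>]\<close>; \<open>W\<close> is \<^term>\<open>joint_growth M\<close> or
  \<^term>\<open>separated_growth M\<close>.\<close>

definition gs_norm ::
    "(nat ^ 'n::finite \<Rightarrow> nat ^ 'n \<Rightarrow> real) \<Rightarrow> real \<Rightarrow> (real ^ 'n \<Rightarrow> complex) \<Rightarrow> ennreal" where
  "gs_norm W h f = (SUP \<alpha>. SUP \<beta>.
     (SUP x. ennreal (cmod (complex_of_real (mi_monom x \<alpha>) * mi_deriv \<beta> f x)))
       / ennreal (h ^ mi_size (\<alpha> + \<beta>) * W \<alpha> \<beta>))"

definition gs_step ::
    "(nat ^ 'n::finite \<Rightarrow> nat ^ 'n \<Rightarrow> real) \<Rightarrow> real \<Rightarrow> (real ^ 'n \<Rightarrow> complex) set" where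
  "gs_step W h = {f \<in> C_infinity. gs_norm W h f < \<infinity>}"

definition gs_step_topology ::
    "(nat ^ 'n::finite \<Rightarrow> nat ^ 'n \<Rightarrow> real) \<Rightarrow> real \<Rightarrow> (real ^ 'n \<Rightarrow> complex) topology" where
  "gs_step_topology W h = seminorm_topology (gs_step W h) {\<lambda>f. enn2real (gs_norm W h f)}"

text \<open>The classes \<open>\<S>\<^bsub>{M}\<^esub>\<close> and \<open>\<S>\<^bsub>(M)\<^esub>\<close>; the argument \<open>G\<close> is \<^const>\<open>joint_growth\<close> or
  \<^const>\<open>separated_growth\<close>.\<close>

definition gs_roumieu ::
    "((nat ^ 'n::finite \<Rightarrow> real) \<Rightarrow> nat ^ 'n \<Rightarrow> nat ^ 'n \<Rightarrow> real) \<Rightarrow>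
     (real \<Rightarrow> nat ^ 'n \<Rightarrow> real) \<Rightarrow> (real ^ 'n \<Rightarrow> complex) set" where
  "gs_roumieu G M = {f \<in> C_infinity. \<exists>l>0. \<exists>h>0. gs_norm (G (M l)) h f < \<infinity>}"

definition gs_roumieu_topology ::
    "((nat ^ 'n::finite \<Rightarrow> real) \<Rightarrow> nat ^ 'n \<Rightarrow> nat ^ 'n \<Rightarrow> real) \<Rightarrow>
     (real \<Rightarrow> nat ^ 'n \<Rightarrow> real) \<Rightarrow> (real ^ 'n \<Rightarrow> complex) topology" where
  "gs_roumieu_topology G M =
     lc_inductive_limit ({0<..} \<times> {0<..}) (\<lambda>(l, h). gs_step_topology (G (M l)) h)"

definition gs_beurling ::
    "((nat ^ 'n::finite \<Rightarrow> real) \<Rightarrow> nat ^ 'n \<Rightarrow> nat ^ 'n \<Rightarrow> real) \<Rightarrow>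
     (real \<Rightarrow> nat ^ 'n \<Rightarrow> real) \<Rightarrow> (real ^ 'n \<Rightarrow> complex) set" where
  "gs_beurling G M = {f \<in> C_infinity. \<forall>l>0. \<forall>h>0. gs_norm (G (M l)) h f < \<infinity>}"

definition gs_beurling_topology ::
    "((nat ^ 'n::finite \<Rightarrow> real) \<Rightarrow> nat ^ 'n \<Rightarrow> nat ^ 'n \<Rightarrow> real) \<Rightarrow>
     (real \<Rightarrow> nat ^ 'n \<Rightarrow> real) \<Rightarrow> (real ^ 'n \<Rightarrow> complex) topology" where
  "gs_beurling_topology G M =
     projective_limit ({0<..} \<times> {0<..}) (\<lambda>(l, h). gs_step_topology (G (M l)) h)"

lemma topspace_gs_roumieu_topology: "topspace (gs_roumieu_topology G M) = gs_roumieu G M"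
proof -
  have "topspace (gs_roumieu_topology G M) = (\<Union>(l, h)\<in>{0<..} \<times> {0<..}. gs_step (G (M l)) h)"
    by (simp add: gs_roumieu_topology_def topspace_lc_inductive_limit gs_step_topology_def
        case_prod_unfold)
  also have "\<dots> = gs_roumieu G M"
    unfolding gs_step_def gs_roumieu_def
    by (intro set_eqI, simp only: UN_iff mem_Collect_eq Bex_def mem_Sigma_iff greaterThan_iff
        split_paired_Ex case_prod_conv) metis
  finally show ?thesis .
qed

lemma topspace_gs_beurling_topology: "topspace (gs_beurling_topology G M) = gs_beurling G M"
proof -
  have one: "(1, 1) \<in> ({0<..} \<times> {0<..} :: (real \<times> real) set)"
    by simp
  then have "({0<..} \<times> {0<..} :: (real \<times> real) set) \<noteq> {}"
    by blast
  then have "topspace (gs_beurling_topology G M) =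
      (\<Inter>(l, h)\<in>{0<..} \<times> {0<..}. gs_step (G (M l)) h)"
    by (simp add: gs_beurling_topology_def topspace_projective_limit gs_step_topology_def
        case_prod_unfold)
  also have "\<dots> = gs_beurling G M"
  proof (intro equalityI subsetI)
    fix f assume f: "f \<in> (\<Inter>(l, h)\<in>{0<..} \<times> {0<..}. gs_step (G (M l)) h)"
    then have "f \<in> gs_step (G (M l)) h" if "0 < l" "0 < h" for l h
      using that by simp
    from this [of 1 1] this show "f \<in> gs_beurling G M"
      by (simp add: gs_step_def gs_beurling_def)
  qed (simp add: gs_step_def gs_beurling_def case_prod_unfold)
  finally show ?thesis .
qed

definition continuously_included ::
    "((nat ^ 'n::finite \<Rightarrow> real) \<Rightarrow> nat ^ 'n \<Rightarrow> nat ^ 'n \<Rightarrow> real) \<Rightarrow>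
     (real \<Rightarrow> nat ^ 'n \<Rightarrow> real) \<Rightarrow> (real \<Rightarrow> nat ^ 'n \<Rightarrow> real) \<Rightarrow> bool" where
  "continuously_included G M N \<longleftrightarrow>
     gs_roumieu G M \<subseteq> gs_beurling G N \<and>
     continuous_map (gs_roumieu_topology G M) (gs_beurling_topology G N) (\<lambda>f. f)"

end

theory Submission
  imports Defs
begin

text \<open>Both implications rest on a reformulation of the relation \<open>M \<lhd> N\<close> between two sequences without
limits: for every \<open>q > 0\<close> there is a \<open>C\<close> with \<open>M\<^sub>\<alpha> \<le> C q\<^bsup>|\<alpha>|\<^esup> N\<^sub>\<alpha>\<close> for all \<open>\<alpha>\<close>
(\<open>seq_strictly_below_iff\<close>).

If all sequences of \<open>M\<close> are strictly below all sequences of \<open>N\<close>, then the free factor \<open>q\<^bsup>|\<alpha>|\<^esup>\<close>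
absorbs any change of the parameter \<open>h\<close>, so every Beurling norm for \<open>N\<close> is bounded on every step of
the Roumieu class for \<open>M\<close> by a multiple of the norm of that step. This gives the inclusion. It also
gives continuity: each Beurling norm defines a locally convex topology on the Roumieu class, the
steps embed continuously into it, and the inductive limit topology is finer than any such topology
(\<open>continuously_included_if_dominated\<close>).

Conversely, let \<open>d = 1\<close> and suppose that the Roumieu class for \<open>M\<close> is contained in the Beurling class
for \<open>N\<close>. It suffices to find, for every \<open>\<lambda>\<close>, a function \<open>f\<close> in the Roumieu class whose derivatives
at the origin are as large as the sequence permits, \<open>|f\<^bsup>(p)\<^esup>(0)| \<ge> M\<^sub>p\<^bsup>(\<lambda>)\<^esup>\<close>. Being in the
Beurling class, \<open>f\<close> satisfies \<open>|f\<^bsup>(p)\<^esup>(0)| \<le> C q\<^sup>p N\<^sub>p\<^bsup>(\<kappa>)\<^esup>\<close> for all \<open>\<kappa>\<close> and \<open>q\<close>, which is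
\<open>M\<^bsup>(\<lambda>)\<^esup> \<lhd> N\<^bsup>(\<kappa>)\<^esup>\<close> (\<open>strictly_below_if_extremal_functions\<close>).

Such an \<open>f\<close> is the product of two factors. The first one is the classical series
\<open>\<theta>(t) = \<Sum>\<^sub>k M\<^sub>k (2\<mu>\<^sub>k)\<^bsup>-k\<^esup> exp(2i\<mu>\<^sub>k t)\<close> with \<open>\<mu>\<^sub>k = M\<^sub>k\<^sub>+\<^sub>1 / M\<^sub>k\<close>: by log-convexity
\<open>M\<^sub>k \<mu>\<^sub>k\<^bsup>p-k\<^esup> \<le> M\<^sub>p\<close>, hence \<open>|\<theta>\<^bsup>(p)\<^esup>| \<le> 2\<^bsup>p+1\<^esup> M\<^sub>p\<close> everywhere, while
\<open>\<theta>\<^bsup>(p)\<^esup>(0)\<close> is \<open>i\<^sup>p\<close> times a sum of positive numbers that contains \<open>M\<^sub>p\<close>. The second factor is the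
Gaussian \<open>exp(-t\<^sup>2/2)\<close>, which provides the decay at infinity. Its \<open>j\<close>-th derivative at the origin is
\<open>i\<^sup>j\<close> times a nonnegative number as well, so no cancellation occurs in the Leibniz formula at the
origin and the lower bound survives the multiplication (\<open>norm_test_deriv_at_0_ge\<close>). The Gaussian
costs factors \<open>\<alpha>\<^bsup>\<alpha>/2\<^esup>\<close> and \<open>j\<^bsup>j/2\<^esup>\<close> in the upper bounds, and condition (R1) says precisely that
these can be paid for inside the weight matrix (\<open>extremal_function\<close>).\<close>

section \<open>The strict order of weight sequences as an inequality\<close>

lemma mi_size_add: "mi_size (\<alpha> + \<beta>) = mi_size \<alpha> + mi_size \<beta>"
  by (simp add: mi_size_def sum.distrib)

lemma finite_mi_size_less: "finite {\<alpha> :: nat ^ 'n::finite. mi_size \<alpha> < m}"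
proof (rule finite_subset)
  show "{\<alpha> :: nat ^ 'n. mi_size \<alpha> < m} \<subseteq> vec_lambda ` (UNIV \<rightarrow>\<^sub>E {..<m})"
  proof
    fix \<alpha> :: "nat ^ 'n" assume "\<alpha> \<in> {\<alpha>. mi_size \<alpha> < m}"
    moreover have "\<alpha> $ i \<le> mi_size \<alpha>" for i
      unfolding mi_size_def by (rule member_le_sum) auto
    ultimately have "(\<lambda>i. \<alpha> $ i) \<in> UNIV \<rightarrow>\<^sub>E {..<m}"
      by (auto simp: PiE_iff intro: le_less_trans)
    then show "\<alpha> \<in> vec_lambda ` (UNIV \<rightarrow>\<^sub>E {..<m})"
      by (metis image_eqI vec_nth_inverse)
  qed
qed (intro finite_imageI finite_PiE, auto)

text \<open>Passing from the limit to the inequality, only finitely many multi-indices escape the limit, and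
they are taken care of by enlarging the constant. Conversely, the inequality with \<open>\<epsilon>/2\<close> in place of
\<open>q\<close> leaves a factor \<open>C 2\<^bsup>-|\<alpha>|\<^esup>\<close>, which is eventually below \<open>1\<close>.\<close>

lemma seq_strictly_below_iff:
  fixes M N :: "nat ^ 'n::finite \<Rightarrow> real"
  assumes M: "\<And>\<alpha>. 0 < M \<alpha>" and N: "\<And>\<alpha>. 0 < N \<alpha>"
  shows "seq_strictly_below M N \<longleftrightarrow> (\<forall>q>0. \<exists>C>0. \<forall>\<alpha>. M \<alpha> \<le> C * q ^ mi_size \<alpha> * N \<alpha>)"
proof (intro iffI allI impI)
  fix q :: real assume q: "0 < q" and "seq_strictly_below M N"
  then have "\<forall>\<^sub>F \<alpha> in filtercomap mi_size at_top. root (mi_size \<alpha>) (M \<alpha> / N \<alpha>) < q"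
    unfolding seq_strictly_below_def by (intro order_tendstoD(2))
  then obtain m where m: "\<And>\<alpha>. m \<le> mi_size \<alpha> \<Longrightarrow> root (mi_size \<alpha>) (M \<alpha> / N \<alpha>) < q"
    unfolding eventually_filtercomap_at_top_linorder by blast
  define S where "S = {\<alpha> :: nat ^ 'n. mi_size \<alpha> < Suc m}"
  define C where "C = 1 + (\<Sum>\<alpha>\<in>S. M \<alpha> / (q ^ mi_size \<alpha> * N \<alpha>))"
  have nonneg: "0 \<le> M \<alpha> / (q ^ mi_size \<alpha> * N \<alpha>)" for \<alpha>
    using q M [of \<alpha>] N [of \<alpha>] by (simp add: less_imp_le)
  have bound: "M \<alpha> / (q ^ mi_size \<alpha> * N \<alpha>) \<le> C" for \<alpha>
  proof (cases "\<alpha> \<in> S")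
    case True
    have "finite S" unfolding S_def by (rule finite_mi_size_less)
    with True nonneg have "M \<alpha> / (q ^ mi_size \<alpha> * N \<alpha>) \<le> (\<Sum>\<alpha>\<in>S. M \<alpha> / (q ^ mi_size \<alpha> * N \<alpha>))"
      by (intro member_le_sum) auto
    then show ?thesis by (simp add: C_def)
  next
    case False
    then have size: "m \<le> mi_size \<alpha>" "0 < mi_size \<alpha>" by (auto simp: S_def)
    have "M \<alpha> / N \<alpha> = root (mi_size \<alpha>) (M \<alpha> / N \<alpha>) ^ mi_size \<alpha>"
      using size M [of \<alpha>] N [of \<alpha>] by (simp add: less_imp_le)
    also have "\<dots> \<le> q ^ mi_size \<alpha>"
      using m [OF size(1)] M [of \<alpha>] N [of \<alpha>] by (intro power_mono real_root_ge_zero) (auto simp: less_imp_le)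
    finally have "M \<alpha> / (q ^ mi_size \<alpha> * N \<alpha>) \<le> 1"
      using q N [of \<alpha>] by (simp add: field_simps)
    also have "1 \<le> C" using nonneg by (simp add: C_def sum_nonneg)
    finally show ?thesis .
  qed
  have "M \<alpha> \<le> C * q ^ mi_size \<alpha> * N \<alpha>" for \<alpha>
    using bound [of \<alpha>] q N [of \<alpha>] by (simp add: field_simps)
  moreover have "0 < C"
    unfolding C_def by (intro add_pos_nonneg sum_nonneg nonneg) simp
  ultimately show "\<exists>C>0. \<forall>\<alpha>. M \<alpha> \<le> C * q ^ mi_size \<alpha> * N \<alpha>" by blast
next
  assume *: "\<forall>q>0. \<exists>C>0. \<forall>\<alpha>. M \<alpha> \<le> C * q ^ mi_size \<alpha> * N \<alpha>"
  show "seq_strictly_below M N"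
    unfolding seq_strictly_below_def
  proof (rule order_tendstoI)
    fix e :: real assume "e < 0"
    have "0 \<le> root (mi_size \<alpha>) (M \<alpha> / N \<alpha>)" for \<alpha>
      using M [of \<alpha>] N [of \<alpha>] by (cases "mi_size \<alpha> = 0") (auto simp: less_imp_le)
    with \<open>e < 0\<close> have "e < root (mi_size \<alpha>) (M \<alpha> / N \<alpha>)" for \<alpha>
      by (meson less_le_trans)
    then show "\<forall>\<^sub>F \<alpha> in filtercomap mi_size at_top. e < root (mi_size \<alpha>) (M \<alpha> / N \<alpha>)"
      by simp
  next
    fix e :: real assume e: "0 < e"
    then obtain C where C: "0 < C" "\<And>\<alpha>. M \<alpha> \<le> C * (e / 2) ^ mi_size \<alpha> * N \<alpha>"
      using * by (metis half_gt_zero)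
    obtain m where m: "C < 2 ^ m" using real_arch_pow [of 2 C] by auto
    have "root (mi_size \<alpha>) (M \<alpha> / N \<alpha>) < e" if "Suc m \<le> mi_size \<alpha>" for \<alpha>
    proof -
      have "M \<alpha> / N \<alpha> \<le> C * (e / 2) ^ mi_size \<alpha>"
        using C(2) [of \<alpha>] N [of \<alpha>] by (simp add: field_simps)
      also have "\<dots> < 2 ^ mi_size \<alpha> * (e / 2) ^ mi_size \<alpha>"
      proof (intro mult_strict_right_mono)
        have "(2 :: real) ^ m \<le> 2 ^ mi_size \<alpha>" using that by (intro power_increasing) auto
        with m show "C < 2 ^ mi_size \<alpha>" by linarith
      qed (use e in auto)
      also have "\<dots> = e ^ mi_size \<alpha>" by (simp flip: power_mult_distrib)
      finally have "root (mi_size \<alpha>) (M \<alpha> / N \<alpha>) < root (mi_size \<alpha>) (e ^ mi_size \<alpha>)"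
        using that by (intro real_root_less_mono) auto
      with e that show ?thesis by (simp add: real_root_power_cancel)
    qed
    then show "\<forall>\<^sub>F \<alpha> in filtercomap mi_size at_top. root (mi_size \<alpha>) (M \<alpha> / N \<alpha>) < e"
      unfolding eventually_filtercomap_at_top_linorder by blast
  qed
qed

section \<open>Inclusions into projective and out of inductive limits\<close>

text \<open>The universal property of the projective limit, for inclusion maps.\<close>

lemma continuous_map_into_projective_limit:
  assumes "I \<noteq> {}" and "\<And>i. i \<in> I \<Longrightarrow> continuous_map T (X i) (\<lambda>f. f)"
  shows "continuous_map T (projective_limit I X) (\<lambda>f. f)"
proof -
  have sub: "topspace T \<subseteq> (\<Inter>i\<in>I. topspace (X i))"
    using assms(2) by (force simp: continuous_map_def)
  show ?thesis
    unfolding projective_limit_def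
  proof (rule continuous_on_generated_topo)
    fix U assume "U \<in> {(\<Inter>j\<in>I. topspace (X j)) \<inter> U | i U. i \<in> I \<and> openin (X i) U}"
    then obtain i V where V: "i \<in> I" "openin (X i) V" "U = (\<Inter>j\<in>I. topspace (X j)) \<inter> V" by blast
    have "openin T {f \<in> topspace T. f \<in> V}"
      using openin_continuous_map_preimage [OF assms(2) [OF V(1)] V(2)] .
    also have "{f \<in> topspace T. f \<in> V} = (\<lambda>f. f) -` U \<inter> topspace T"
      using sub V(3) by auto
    finally show "openin T ((\<lambda>f. f) -` U \<inter> topspace T)" .
  next
    show "(\<lambda>f. f) ` topspace T \<subseteq> \<Union> {(\<Inter>j\<in>I. topspace (X j)) \<inter> U | i U. i \<in> I \<and> openin (X i) U}"
      using sub topspace_projective_limit [OF assms(1), of X]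
      unfolding projective_limit_def topology_generated_by_topspace by auto
  qed
qed

text \<open>The universal property of the inductive limit, for inclusion maps into spaces on the same set.\<close>

lemma continuous_map_lc_inductive_limit:
  assumes "locally_convex_topology_on (\<Union>i\<in>I. topspace (X i)) T"
    and "\<And>i. i \<in> I \<Longrightarrow> continuous_map (X i) T (\<lambda>f. f)"
  shows "continuous_map (lc_inductive_limit I X) T (\<lambda>f. f)"
  unfolding continuous_map_def
proof (intro conjI allI impI)
  show "(\<lambda>f. f) \<in> topspace (lc_inductive_limit I X) \<rightarrow> topspace T"
    using locally_convex_topology_on_topspace [OF assms(1)] by (simp add: topspace_lc_inductive_limit)
  fix U assume U: "openin T U"
  then have "openin (lc_inductive_limit I X) U"
    using assms by (intro lc_inductive_limit_finest)
  moreover from this have "{x \<in> topspace (lc_inductive_limit I X). x \<in> U} = U"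
    using openin_subset by blast
  ultimately show "openin (lc_inductive_limit I X) {x \<in> topspace (lc_inductive_limit I X). x \<in> U}"
    by simp
qed

text \<open>A bounded inclusion of seminormed spaces is continuous. The space \<open>V'\<close> carries the restriction of
the seminorm \<open>q\<close> of an ambient vector space \<open>W\<close>; keeping the two apart makes the lemma applicable to
unions \<open>V'\<close> of steps without first proving that they are closed under subtraction.\<close>

lemma continuous_map_seminorm_topology:
  assumes V: "V \<subseteq> V'" "V' \<subseteq> W"
    and p: "seminorm_on V p" and q: "seminorm_on W q"
    and diff: "\<And>f g. f \<in> W \<Longrightarrow> g \<in> W \<Longrightarrow> (\<lambda>x. f x - g x) \<in> W"
    and C: "0 < C" "\<And>f g. f \<in> V \<Longrightarrow> g \<in> V \<Longrightarrow> q (\<lambda>x. f x - g x) \<le> C * p (\<lambda>x. f x - g x)"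
  shows "continuous_map (seminorm_topology V {p}) (seminorm_topology V' {q}) (\<lambda>f. f)"
  unfolding seminorm_topology_def [of V']
proof (rule continuous_on_generated_topo)
  show "(\<lambda>f. f) ` topspace (seminorm_topology V {p}) \<subseteq>
      \<Union> (insert V' {{f \<in> V'. p (\<lambda>x. f x - g x) < r} |p g r. p \<in> {q} \<and> g \<in> V' \<and> 0 < r})"
    using V(1) by auto
  fix U assume "U \<in> insert V' {{f \<in> V'. p (\<lambda>x. f x - g x) < r} |p g r. p \<in> {q} \<and> g \<in> V' \<and> 0 < r}"
  then consider "U = V'" | g r where "U = {f \<in> V'. q (\<lambda>x. f x - g x) < r}" "g \<in> V'" "0 < r" by blast
  then show "openin (seminorm_topology V {p}) ((\<lambda>f. f) -` U \<inter> topspace (seminorm_topology V {p}))"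
  proof cases
    case 1
    with V(1) have "(\<lambda>f. f) -` U \<inter> topspace (seminorm_topology V {p}) = topspace (seminorm_topology V {p})"
      by auto
    then show ?thesis by (metis openin_topspace)
  next
    case 2
    have eq: "(\<lambda>f. f) -` U \<inter> topspace (seminorm_topology V {p}) = {f \<in> V. q (\<lambda>x. f x - g x) < r}"
      using 2(1) V(1) by auto
    show ?thesis
      unfolding eq
    proof (subst openin_subopen, intro ballI)
      fix f0 assume f0: "f0 \<in> {f \<in> V. q (\<lambda>x. f x - g x) < r}"
      \<comment> \<open>the \<open>p\<close>-ball of this radius around \<open>f0\<close> stays inside the given \<open>q\<close>-ball around \<open>g\<close>\<close>
      define \<delta> where "\<delta> = (r - q (\<lambda>x. f0 x - g x)) / C"
      have "0 < \<delta>" using f0 C(1) by (simp add: \<delta>_def)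
      \<comment> \<open>\<open>V\<close> need not contain \<open>0\<close>, so \<open>p 0 = 0\<close> is read off from homogeneity at \<open>f0\<close>\<close>
      have "p (\<lambda>x. 0 * f0 x) = cmod 0 * p f0"
        using p f0 unfolding seminorm_on_def by blast
      then have p0: "p (\<lambda>x. f0 x - f0 x) = 0" by simp
      have "openin (seminorm_topology V {p}) {f \<in> V. p (\<lambda>x. f x - f0 x) < \<delta>}"
        using f0 \<open>0 < \<delta>\<close> by (intro openin_seminorm_topology_ball) auto
      moreover have "f0 \<in> {f \<in> V. p (\<lambda>x. f x - f0 x) < \<delta>}"
        using f0 p0 \<open>0 < \<delta>\<close> by simp
      moreover have "q (\<lambda>x. f x - g x) < r" if f: "f \<in> V" "p (\<lambda>x. f x - f0 x) < \<delta>" for f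
      proof -
        have W: "f \<in> W" "f0 \<in> W" "g \<in> W" using f(1) f0 2(2) V by auto
        have "q (\<lambda>x. f x - g x) = q (\<lambda>x. (f x - f0 x) + (f0 x - g x))" by simp
        also have "\<dots> \<le> q (\<lambda>x. f x - f0 x) + q (\<lambda>x. f0 x - g x)"
          using q diff [OF W(1,2)] diff [OF W(2,3)] unfolding seminorm_on_def
          by (elim conjE) (drule (1) bspec, drule (1) bspec)
        also have "q (\<lambda>x. f x - f0 x) \<le> C * p (\<lambda>x. f x - f0 x)"
          using C(2) f(1) f0 by blast
        also have "C * p (\<lambda>x. f x - f0 x) < r - q (\<lambda>x. f0 x - g x)"
          using f(2) C(1) by (simp add: \<delta>_def field_simps)
        finally show ?thesis by simp
      qed
      ultimately show "\<exists>T. openin (seminorm_topology V {p}) T \<and> f0 \<in> T \<and>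
          T \<subseteq> {f \<in> V. q (\<lambda>x. f x - g x) < r}"
        by (intro exI [of _ "{f \<in> V. p (\<lambda>x. f x - f0 x) < \<delta>}"]) auto
    qed
  qed
qed

section \<open>The weighted norms are seminorms\<close>

lemma iter_partial_add:
  assumes "f \<in> C_infinity" "g \<in> C_infinity"
  shows "iter_partial is (\<lambda>x. f x + g x) = (\<lambda>x. iter_partial is f x + iter_partial is g x)"
proof (induction "is")
  case (Cons i "is")
  then show ?case
    using assms by (auto simp: fun_eq_iff partial_deriv_def C_infinity_def has_partial_deriv_at_def
        intro!: vector_derivative_add_at)
qed simp

lemma iter_partial_cmult:
  assumes "f \<in> C_infinity"
  shows "iter_partial is (\<lambda>x. c * f x) = (\<lambda>x. c * iter_partial is f x)"
proof (induction "is")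
  case (Cons i "is")
  then show ?case
    using assms
    by (auto simp: fun_eq_iff partial_deriv_def C_infinity_def has_partial_deriv_at_def
        vector_derivative_works [symmetric]
        intro!: vector_derivative_at has_vector_derivative_mult_right vector_derivative_works [THEN iffD1])
qed simp

lemma C_infinity_add:
  "f \<in> C_infinity \<Longrightarrow> g \<in> C_infinity \<Longrightarrow> (\<lambda>x. f x + g x) \<in> C_infinity"
  using iter_partial_add [of f g]
  by (auto simp: C_infinity_def has_partial_deriv_at_def intro!: continuous_intros)

lemma C_infinity_cmult: "f \<in> C_infinity \<Longrightarrow> (\<lambda>x. c * f x) \<in> C_infinity"
  using iter_partial_cmult [of f]
  by (auto simp: C_infinity_def has_partial_deriv_at_def intro!: continuous_intros)

text \<open>The quotients whose supremum is \<^const>\<open>gs_norm\<close>, as real numbers. With them the norm becomes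
a single supremum over pointwise quantities, and its properties follow from pointwise ones.\<close>

definition gs_ratio ::
    "(nat ^ 'n::finite \<Rightarrow> nat ^ 'n \<Rightarrow> real) \<Rightarrow> real \<Rightarrow> (real ^ 'n \<Rightarrow> complex) \<Rightarrow>
      nat ^ 'n \<Rightarrow> nat ^ 'n \<Rightarrow> real ^ 'n \<Rightarrow> real" where
  "gs_ratio W h f \<alpha> \<beta> x =
    cmod (complex_of_real (mi_monom x \<alpha>) * mi_deriv \<beta> f x) / (h ^ mi_size (\<alpha> + \<beta>) * W \<alpha> \<beta>)"

context
  fixes W :: "nat ^ 'n::finite \<Rightarrow> nat ^ 'n \<Rightarrow> real" and h :: real
  assumes W: "0 < W \<alpha> \<beta>" and h: "0 < h"
begin

lemma gs_norm_eq: "gs_norm W h f = (SUP \<alpha>. SUP \<beta>. SUP x. ennreal (gs_ratio W h f \<alpha> \<beta> x))"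
  using W h by (simp add: gs_norm_def gs_ratio_def SUP_divide_ennreal divide_ennreal)

lemma gs_norm_le_iff: "gs_norm W h f \<le> c \<longleftrightarrow> (\<forall>\<alpha> \<beta> x. ennreal (gs_ratio W h f \<alpha> \<beta> x) \<le> c)"
  by (simp add: gs_norm_eq SUP_le_iff)

lemma gs_ratio_le_gs_norm: "ennreal (gs_ratio W h f \<alpha> \<beta> x) \<le> gs_norm W h f"
  using gs_norm_le_iff by blast

lemma gs_norm_finite_iff: "gs_norm W h f < \<infinity> \<longleftrightarrow>
   (\<exists>K>0. \<forall>\<alpha> \<beta> x. cmod (complex_of_real (mi_monom x \<alpha>) * mi_deriv \<beta> f x) \<le> K * (h ^ mi_size (\<alpha> + \<beta>) * W \<alpha> \<beta>))"
proof -
  have iff: "cmod (complex_of_real (mi_monom x \<alpha>) * mi_deriv \<beta> f x) \<le> K * (h ^ mi_size (\<alpha> + \<beta>) * W \<alpha> \<beta>)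
      \<longleftrightarrow> ennreal (gs_ratio W h f \<alpha> \<beta> x) \<le> ennreal K" if "0 < K" for K \<alpha> \<beta> x
    using W [of \<alpha> \<beta>] h that by (simp add: gs_ratio_def pos_divide_le_eq)
  show ?thesis
  proof
    assume fin: "gs_norm W h f < \<infinity>"
    define K where "K = enn2real (gs_norm W h f) + 1"
    have "gs_norm W h f \<le> ennreal K"
      using fin by (cases "gs_norm W h f") (auto simp: K_def intro!: ennreal_leI)
    moreover have "0 < K" using enn2real_nonneg [of "gs_norm W h f"] unfolding K_def by linarith
    ultimately show "\<exists>K>0. \<forall>\<alpha> \<beta> x. cmod (complex_of_real (mi_monom x \<alpha>) * mi_deriv \<beta> f x) \<le> K * (h ^ mi_size (\<alpha> + \<beta>) * W \<alpha> \<beta>)"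
      using iff gs_norm_le_iff by blast
  next
    assume "\<exists>K>0. \<forall>\<alpha> \<beta> x. cmod (complex_of_real (mi_monom x \<alpha>) * mi_deriv \<beta> f x) \<le> K * (h ^ mi_size (\<alpha> + \<beta>) * W \<alpha> \<beta>)"
    then obtain K where "gs_norm W h f \<le> ennreal K"
      using iff gs_norm_le_iff by blast
    then show "gs_norm W h f < \<infinity>" by (simp add: le_less_trans)
  qed
qed

lemma gs_norm_add:
  assumes "f \<in> C_infinity" "g \<in> C_infinity"
  shows "gs_norm W h (\<lambda>x. f x + g x) \<le> gs_norm W h f + gs_norm W h g"
  unfolding gs_norm_le_iff
proof (intro allI)
  fix \<alpha> \<beta> x
  have "gs_ratio W h (\<lambda>x. f x + g x) \<alpha> \<beta> x \<le> gs_ratio W h f \<alpha> \<beta> x + gs_ratio W h g \<alpha> \<beta> x"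
    using assms W [of \<alpha> \<beta>] h
    by (auto simp: gs_ratio_def mi_deriv_def iter_partial_add distrib_left norm_triangle_ineq
        intro!: divide_right_mono simp flip: add_divide_distrib)
  then have "ennreal (gs_ratio W h (\<lambda>x. f x + g x) \<alpha> \<beta> x) \<le>
      ennreal (gs_ratio W h f \<alpha> \<beta> x) + ennreal (gs_ratio W h g \<alpha> \<beta> x)"
    using W [of \<alpha> \<beta>] h
    by (subst ennreal_plus [symmetric]) (auto simp: gs_ratio_def less_imp_le simp del: ennreal_plus intro!: ennreal_leI)
  also have "\<dots> \<le> gs_norm W h f + gs_norm W h g"
    by (intro add_mono gs_ratio_le_gs_norm)
  finally show "ennreal (gs_ratio W h (\<lambda>x. f x + g x) \<alpha> \<beta> x) \<le> gs_norm W h f + gs_norm W h g" .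
qed

lemma gs_norm_cmult:
  assumes "f \<in> C_infinity"
  shows "gs_norm W h (\<lambda>x. c * f x) = ennreal (cmod c) * gs_norm W h f"
proof -
  have "gs_ratio W h (\<lambda>x. c * f x) \<alpha> \<beta> x = cmod c * gs_ratio W h f \<alpha> \<beta> x" for \<alpha> \<beta> x
    using assms by (simp add: gs_ratio_def mi_deriv_def iter_partial_cmult norm_mult)
  then show ?thesis
    by (simp add: gs_norm_eq SUP_mult_left_ennreal ennreal_mult')
qed

lemma gs_step_add: "f \<in> gs_step W h \<Longrightarrow> g \<in> gs_step W h \<Longrightarrow> (\<lambda>x. f x + g x) \<in> gs_step W h"
  by (auto simp: gs_step_def C_infinity_add intro: le_less_trans [OF gs_norm_add])

lemma gs_step_cmult: "f \<in> gs_step W h \<Longrightarrow> (\<lambda>x. c * f x) \<in> gs_step W h"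
  by (auto simp: gs_step_def C_infinity_cmult gs_norm_cmult ennreal_mult_less_top)

lemma gs_step_diff: "f \<in> gs_step W h \<Longrightarrow> g \<in> gs_step W h \<Longrightarrow> (\<lambda>x. f x - g x) \<in> gs_step W h"
  using gs_step_add [of f "\<lambda>x. - 1 * g x"] gs_step_cmult [of g "- 1"] by simp

lemma seminorm_on_gs_step: "seminorm_on (gs_step W h) (\<lambda>f. enn2real (gs_norm W h f))"
  unfolding seminorm_on_def
proof (intro conjI ballI allI)
  fix f g assume fg: "f \<in> gs_step W h" "g \<in> gs_step W h"
  then have "enn2real (gs_norm W h (\<lambda>x. f x + g x)) \<le> enn2real (gs_norm W h f + gs_norm W h g)"
    by (intro enn2real_mono gs_norm_add) (auto simp: gs_step_def)
  also have "\<dots> = enn2real (gs_norm W h f) + enn2real (gs_norm W h g)"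
    using fg by (intro enn2real_plus) (auto simp: gs_step_def)
  finally show "enn2real (gs_norm W h (\<lambda>x. f x + g x)) \<le> enn2real (gs_norm W h f) + enn2real (gs_norm W h g)" .
qed (auto simp: gs_step_def gs_norm_cmult enn2real_mult)

end

lemma gs_norm_le_mult:
  assumes W: "\<And>\<alpha> \<beta>. 0 < W \<alpha> \<beta>" "0 < h" and W': "\<And>\<alpha> \<beta>. 0 < W' \<alpha> \<beta>" "0 < h'"
    and C: "0 < C" "\<And>\<alpha> \<beta>. h ^ mi_size (\<alpha> + \<beta>) * W \<alpha> \<beta> \<le> C * (h' ^ mi_size (\<alpha> + \<beta>) * W' \<alpha> \<beta>)"
  shows "gs_norm W' h' f \<le> ennreal C * gs_norm W h f"
  unfolding gs_norm_le_iff [OF W']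
proof (intro allI)
  fix \<alpha> \<beta> x
  define a where "a = cmod (complex_of_real (mi_monom x \<alpha>) * mi_deriv \<beta> f x)"
  define w w' where "w = h ^ mi_size (\<alpha> + \<beta>) * W \<alpha> \<beta>" and "w' = h' ^ mi_size (\<alpha> + \<beta>) * W' \<alpha> \<beta>"
  have w: "0 < w" "0 < w'" "w \<le> C * w'" "0 \<le> a"
    using assms by (auto simp: w_def w'_def a_def)
  then have "a * w \<le> a * (C * w')" by (intro mult_left_mono)
  with w have "a / w' \<le> C * (a / w)" by (simp add: field_simps)
  then have "ennreal (gs_ratio W' h' f \<alpha> \<beta> x) \<le> ennreal (C * gs_ratio W h f \<alpha> \<beta> x)"
    by (intro ennreal_leI) (simp add: gs_ratio_def a_def w_def w'_def)
  also have "\<dots> = ennreal C * ennreal (gs_ratio W h f \<alpha> \<beta> x)"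
    using C(1) by (intro ennreal_mult') simp
  also have "\<dots> \<le> ennreal C * gs_norm W h f"
    by (intro mult_left_mono gs_ratio_le_gs_norm W) simp
  finally show "ennreal (gs_ratio W' h' f \<alpha> \<beta> x) \<le> ennreal C * gs_norm W h f" .
qed

section \<open>Strictly dominated matrices give continuous inclusions\<close>

text \<open>The analytic input is only the domination \<open>dom\<close>, uniform in \<open>\<alpha>\<close> and \<open>\<beta>\<close>; stated
for an arbitrary way \<open>G\<close> in which the sequences enter the norms, it covers joint and separated growth.\<close>

lemma continuously_included_if_dominated:
  fixes M N :: "real \<Rightarrow> nat ^ 'n::finite \<Rightarrow> real"
  assumes GM: "\<And>l \<alpha> \<beta>. 0 < l \<Longrightarrow> 0 < G (M l) \<alpha> \<beta>" and GN: "\<And>l \<alpha> \<beta>. 0 < l \<Longrightarrow> 0 < G (N l) \<alpha> \<beta>"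
    and dom: "\<And>l k q. 0 < l \<Longrightarrow> 0 < k \<Longrightarrow> 0 < q \<Longrightarrow>
      \<exists>C>0. \<forall>\<alpha> \<beta>. G (M l) \<alpha> \<beta> \<le> C * q ^ mi_size (\<alpha> + \<beta>) * G (N k) \<alpha> \<beta>"
  shows "continuously_included G M N"
proof -
  have cmp: "\<exists>C>0. \<forall>f. gs_norm (G (N k)) h' f \<le> ennreal C * gs_norm (G (M l)) h f"
    if pos: "0 < l" "0 < h" "0 < k" "0 < h'" for l h k h'
  proof -
    obtain C where C: "0 < C" "\<And>\<alpha> \<beta>. G (M l) \<alpha> \<beta> \<le> C * (h' / h) ^ mi_size (\<alpha> + \<beta>) * G (N k) \<alpha> \<beta>"
      using dom [of l k "h' / h"] pos by auto
    have "h ^ mi_size (\<alpha> + \<beta>) * G (M l) \<alpha> \<beta> \<le> C * (h' ^ mi_size (\<alpha> + \<beta>) * G (N k) \<alpha> \<beta>)" for \<alpha> \<beta>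
      using C(2) [of \<alpha> \<beta>] pos by (simp add: power_divide field_simps)
    then have "gs_norm (G (N k)) h' f \<le> ennreal C * gs_norm (G (M l)) h f" for f
      using pos C(1) by (intro gs_norm_le_mult GM GN)
    with C(1) show ?thesis by blast
  qed
  have step: "gs_step (G (M l)) h \<subseteq> gs_step (G (N k)) h'"
    if "0 < l" "0 < h" "0 < k" "0 < h'" for l h k h'
    using cmp [OF that] by (auto simp: gs_step_def ennreal_mult_less_top intro: le_less_trans)
  have roumieu: "gs_roumieu G M = (\<Union>i\<in>{0<..} \<times> {0<..}. topspace (case i of (l, h) \<Rightarrow> gs_step_topology (G (M l)) h))"
    using topspace_gs_roumieu_topology [of G M]
    unfolding gs_roumieu_topology_def topspace_lc_inductive_limit by simp
  have sub: "gs_roumieu G M \<subseteq> gs_step (G (N k)) h'" if "0 < k" "0 < h'" for k h'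
    using step that by (auto simp: gs_roumieu_def gs_step_def) blast
  have "continuous_map (gs_roumieu_topology G M) (gs_step_topology (G (N k)) h') (\<lambda>f. f)"
    if k: "0 < k" "0 < h'" for k h'
  proof -
    \<comment> \<open>the inclusion is factored through the whole Roumieu class with the single norm of the target\<close>
    define q where "q = (\<lambda>f. enn2real (gs_norm (G (N k)) h' f))"
    define T where "T = seminorm_topology (gs_roumieu G M) {q}"
    note q = seminorm_on_gs_step [of "G (N k)" h', OF GN [OF k(1)] k(2), folded q_def]
    note diff = gs_step_diff [of "G (N k)" h', OF GN [OF k(1)] k(2)]
    have q': "seminorm_on (gs_roumieu G M) q"
      using q sub [OF k] unfolding seminorm_on_def by blast
    have "continuous_map (gs_step_topology (G (M l)) h) T (\<lambda>f. f)" if l: "0 < l" "0 < h" for l h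
    proof -
      obtain C where C: "0 < C" "\<And>f. gs_norm (G (N k)) h' f \<le> ennreal C * gs_norm (G (M l)) h f"
        using cmp [OF l k] by blast
      note GMl = GM [OF l(1)] l(2)
      show ?thesis
        unfolding T_def gs_step_topology_def
      proof (rule continuous_map_seminorm_topology [OF _ sub [OF k] _ q diff C(1)])
        show "gs_step (G (M l)) h \<subseteq> gs_roumieu G M"
          using l by (auto simp: gs_step_def gs_roumieu_def)
        show "seminorm_on (gs_step (G (M l)) h) (\<lambda>f. enn2real (gs_norm (G (M l)) h f))"
          by (rule seminorm_on_gs_step [OF GMl])
        show "q (\<lambda>x. f x - g x) \<le> C * enn2real (gs_norm (G (M l)) h (\<lambda>x. f x - g x))"
          if "f \<in> gs_step (G (M l)) h" "g \<in> gs_step (G (M l)) h" for f g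
        proof -
          have "gs_norm (G (M l)) h (\<lambda>x. f x - g x) < top"
            using gs_step_diff [OF GMl that] by (simp add: gs_step_def)
          then have "q (\<lambda>x. f x - g x) \<le> enn2real (ennreal C * gs_norm (G (M l)) h (\<lambda>x. f x - g x))"
            unfolding q_def by (intro enn2real_mono C(2)) (simp add: ennreal_mult_less_top)
          then show ?thesis using C(1) by (simp add: enn2real_mult)
        qed
      qed
    qed
    moreover have "locally_convex_topology_on (gs_roumieu G M) T"
      using q' unfolding locally_convex_topology_on_def T_def by blast
    ultimately have "continuous_map (gs_roumieu_topology G M) T (\<lambda>f. f)"
      unfolding gs_roumieu_topology_def roumieu by (intro continuous_map_lc_inductive_limit) auto
    moreover have "continuous_map T (gs_step_topology (G (N k)) h') (\<lambda>f. f)"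
      unfolding T_def gs_step_topology_def q_def [symmetric]
      by (rule continuous_map_seminorm_topology [OF sub [OF k] order_refl q' q diff, of 1]) auto
    ultimately show ?thesis
      using continuous_map_compose [of _ T "\<lambda>f. f" _ "\<lambda>f. f"] by (simp add: o_def)
  qed
  then have "continuous_map (gs_roumieu_topology G M) (gs_beurling_topology G N) (\<lambda>f. f)"
    unfolding gs_beurling_topology_def
    by (intro continuous_map_into_projective_limit) (auto intro: exI [of _ 1])
  moreover have "gs_roumieu G M \<subseteq> gs_beurling G N"
    using sub unfolding gs_beurling_def gs_step_def gs_roumieu_def by blast
  ultimately show ?thesis by (simp add: continuously_included_def)
qed

text \<open>Different geometric factors for the two multi-indices are harmless: the larger one serves as \<open>h\<close>.\<close>

lemma gs_roumieuI:
  fixes M :: "real \<Rightarrow> nat ^ 'n::finite \<Rightarrow> real"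
  assumes f: "f \<in> C_infinity" and pos: "0 < l" "\<And>\<alpha> \<beta>. 0 < G (M l) \<alpha> \<beta>" "0 < K" "0 < u" "0 < v"
    and le: "\<And>\<alpha> \<beta> x. cmod (complex_of_real (mi_monom x \<alpha>) * mi_deriv \<beta> f x) \<le>
      K * (u ^ mi_size \<alpha> * v ^ mi_size \<beta> * G (M l) \<alpha> \<beta>)"
  shows "f \<in> gs_roumieu G M"
proof -
  have "K * (u ^ mi_size \<alpha> * v ^ mi_size \<beta> * G (M l) \<alpha> \<beta>) \<le> K * (max u v ^ mi_size (\<alpha> + \<beta>) * G (M l) \<alpha> \<beta>)" for \<alpha> \<beta>
    unfolding mi_size_add power_add using pos
    by (intro mult_left_mono mult_right_mono mult_mono power_mono) (auto simp: less_imp_le)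
  then have "cmod (complex_of_real (mi_monom x \<alpha>) * mi_deriv \<beta> f x) \<le>
      K * (max u v ^ mi_size (\<alpha> + \<beta>) * G (M l) \<alpha> \<beta>)" for \<alpha> \<beta> x
    using le order_trans by blast
  then have "gs_norm (G (M l)) (max u v) f < \<infinity>"
    using pos by (subst gs_norm_finite_iff) auto
  moreover have "0 < max u v" using pos by simp
  ultimately show ?thesis using f pos(1) unfolding gs_roumieu_def by blast
qed

theorem continuously_included_if_strictly_below:
  fixes M N :: "real \<Rightarrow> nat ^ 'n::finite \<Rightarrow> real"
  assumes M: "weight_matrix M" and N: "weight_matrix N" and below: "matrix_strictly_below M N"
  shows "continuously_included joint_growth M N" and "continuously_included separated_growth M N"
proof -
  have pos: "\<And>l \<alpha>. 0 < l \<Longrightarrow> 0 < M l \<alpha>" "\<And>l \<alpha>. 0 < l \<Longrightarrow> 0 < N l \<alpha>"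
    using M N by (auto simp: weight_matrix_def)
  have dom: "\<exists>C>0. \<forall>\<alpha>. M l \<alpha> \<le> C * q ^ mi_size \<alpha> * N k \<alpha>" if "0 < l" "0 < k" "0 < q" for l k q
    using below seq_strictly_below_iff [of "M l" "N k"] pos that
    by (simp add: matrix_strictly_below_def)
  show "continuously_included joint_growth M N"
  proof (rule continuously_included_if_dominated)
    fix l k q :: real assume "0 < l" "0 < k" "0 < q"
    then show "\<exists>C>0. \<forall>\<alpha> \<beta>. joint_growth (M l) \<alpha> \<beta> \<le> C * q ^ mi_size (\<alpha> + \<beta>) * joint_growth (N k) \<alpha> \<beta>"
      using dom [of l k q] by (auto simp: joint_growth_def)
  qed (simp_all add: joint_growth_def pos)
  show "continuously_included separated_growth M N"
  proof (rule continuously_included_if_dominated)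
    fix l k q :: real assume lkq: "0 < l" "0 < k" "0 < q"
    then obtain C where C: "0 < C" "\<And>\<alpha>. M l \<alpha> \<le> C * q ^ mi_size \<alpha> * N k \<alpha>"
      using dom by blast
    \<comment> \<open>two dominations are multiplied, which squares the constant but not the geometric factor\<close>
    have "M l \<alpha> * M l \<beta> \<le> (C * q ^ mi_size \<alpha> * N k \<alpha>) * (C * q ^ mi_size \<beta> * N k \<beta>)" for \<alpha> \<beta>
      using lkq C pos by (intro mult_mono) (auto simp: less_imp_le)
    also have "(C * q ^ mi_size \<alpha> * N k \<alpha>) * (C * q ^ mi_size \<beta> * N k \<beta>) =
        C\<^sup>2 * q ^ mi_size (\<alpha> + \<beta>) * (N k \<alpha> * N k \<beta>)" for \<alpha> \<beta>
      by (simp add: mi_size_add power_add power2_eq_square)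
    finally show "\<exists>C>0. \<forall>\<alpha> \<beta>. separated_growth (M l) \<alpha> \<beta> \<le> C * q ^ mi_size (\<alpha> + \<beta>) * separated_growth (N k) \<alpha> \<beta>"
      using C(1) by (intro exI [of _ "C\<^sup>2"]) (simp add: separated_growth_def)
  qed (simp_all add: separated_growth_def pos)
qed

section \<open>Termwise differentiation and the Leibniz formula\<close>

text \<open>Termwise differentiation under summable majorants that do not depend on the point.\<close>

lemma has_vector_derivative_suminf:
  fixes f :: "nat \<Rightarrow> real \<Rightarrow> 'b::banach"
  assumes deriv: "\<And>n t. (f n has_vector_derivative f' n t) (at t)"
    and f: "\<And>n t. norm (f n t) \<le> a n" "summable a"
    and f': "\<And>n t. norm (f' n t) \<le> b n" "summable b"
  shows "((\<lambda>t. \<Sum>n. f n t) has_vector_derivative (\<Sum>n. f' n t)) (at t)"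
proof -
  have unif: "uniform_limit UNIV (\<lambda>n t. \<Sum>i<n. f' i t) (\<lambda>t. \<Sum>i. f' i t) sequentially"
    by (rule Weierstrass_m_test) (use f' in auto)
  have sum: "(\<lambda>n. f n s) sums (\<Sum>n. f n s)" for s
    by (intro summable_sums summable_comparison_test' [OF f(2), of 0]) (use f(1) in auto)
  have "\<exists>g. \<forall>s\<in>UNIV. (\<lambda>n. f n s) sums (g s) \<and>
      (g has_derivative (\<lambda>h. h *\<^sub>R (\<Sum>n. f' n s))) (at s within UNIV)"
  proof (rule has_derivative_series [OF convex_UNIV _ _ UNIV_I sum])
    fix e :: real assume "e > 0"
    show "\<forall>\<^sub>F n in sequentially. \<forall>s\<in>UNIV. \<forall>h. norm ((\<Sum>i<n. h *\<^sub>R f' i s) - h *\<^sub>R (\<Sum>n. f' n s)) \<le> e * norm h"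
      using uniform_limitD [OF unif \<open>e > 0\<close>]
    proof eventually_elim
      case (elim n)
      have "norm ((\<Sum>i<n. h *\<^sub>R f' i s) - h *\<^sub>R (\<Sum>n. f' n s)) \<le> e * norm h" for s h
      proof -
        have "norm ((\<Sum>i<n. h *\<^sub>R f' i s) - h *\<^sub>R (\<Sum>n. f' n s)) = \<bar>h\<bar> * norm ((\<Sum>i<n. f' i s) - (\<Sum>n. f' n s))"
          by (simp flip: scaleR_sum_right scaleR_diff_right)
        also have "\<dots> \<le> \<bar>h\<bar> * e"
          using elim by (intro mult_left_mono) (auto simp: dist_norm less_imp_le)
        finally show ?thesis by (simp add: mult.commute)
      qed
      then show ?case by blast
    qed
  qed (use deriv in \<open>simp add: has_vector_derivative_def\<close>)
  then obtain g where g: "\<And>s. (\<lambda>n. f n s) sums (g s)"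
      "\<And>s. (g has_derivative (\<lambda>h. h *\<^sub>R (\<Sum>n. f' n s))) (at s)" by auto
  from g(1) have "g = (\<lambda>s. \<Sum>n. f n s)" by (auto simp: sums_iff)
  with g(2) show ?thesis by (simp add: has_vector_derivative_def)
qed

text \<open>The step from \<open>p\<close> to \<open>p + 1\<close> in the Leibniz formula, for sequences of functions each of which is the
derivative of its predecessor. Pascal's rule merges the two sums.\<close>

lemma has_vector_derivative_Leibniz_sum:
  fixes u v :: "nat \<Rightarrow> real \<Rightarrow> 'a::{real_normed_field}"
  assumes u: "\<And>n t. (u n has_vector_derivative u (Suc n) t) (at t)"
    and v: "\<And>n t. (v n has_vector_derivative v (Suc n) t) (at t)"
  shows "((\<lambda>t. \<Sum>j\<le>p. of_nat (p choose j) * u (p - j) t * v j t) has_vector_derivative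
    (\<Sum>j\<le>Suc p. of_nat (Suc p choose j) * u (Suc p - j) t * v j t)) (at t)"
proof -
  have "((\<lambda>t. \<Sum>j\<le>p. of_nat (p choose j) * u (p - j) t * v j t) has_vector_derivative
    (\<Sum>j\<le>p. of_nat (p choose j) * (u (p - j) t * v (Suc j) t + u (Suc (p - j)) t * v j t))) (at t)"
    unfolding mult.assoc
    by (intro has_vector_derivative_sum has_vector_derivative_mult_right has_vector_derivative_mult u v)
  also have "(\<Sum>j\<le>p. of_nat (p choose j) * (u (p - j) t * v (Suc j) t + u (Suc (p - j)) t * v j t)) =
     (\<Sum>j\<le>p. of_nat (p choose j) * u (Suc p - Suc j) t * v (Suc j) t) +
     (\<Sum>j\<le>p. of_nat (p choose j) * u (Suc p - j) t * v j t)"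
    by (simp add: algebra_simps sum.distrib Suc_diff_le)
  also have "(\<Sum>j\<le>p. of_nat (p choose j) * u (Suc p - j) t * v j t) =
     (\<Sum>j\<le>Suc p. of_nat (p choose j) * u (Suc p - j) t * v j t)" by simp
  also have "\<dots> = u (Suc p) t * v 0 t + (\<Sum>j\<le>p. of_nat (p choose Suc j) * u (Suc p - Suc j) t * v (Suc j) t)"
    by (simp only: sum.atMost_Suc_shift) simp
  also have "(\<Sum>j\<le>p. of_nat (p choose j) * u (Suc p - Suc j) t * v (Suc j) t) + \<dots> =
     (\<Sum>j\<le>Suc p. of_nat (Suc p choose j) * u (Suc p - j) t * v j t)"
    by (simp only: sum.atMost_Suc_shift) (simp add: algebra_simps sum.distrib)
  finally show ?thesis .
qed

section \<open>Derivatives of the Gaussian\<close>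

definition half_power :: "nat \<Rightarrow> real" where
  "half_power n = sqrt (real n ^ n)"

lemma half_power_nonneg [simp]: "0 \<le> half_power n"
  by (simp add: half_power_def)

lemma half_power_Suc_Suc: "real (Suc n) * half_power n \<le> half_power (Suc (Suc n))"
proof -
  have "(real (Suc n))\<^sup>2 * real n ^ n \<le> (real (Suc (Suc n)))\<^sup>2 * real (Suc (Suc n)) ^ n"
    by (intro mult_mono power_mono) auto
  then have "sqrt ((real (Suc n))\<^sup>2 * real n ^ n) \<le> sqrt (real (Suc (Suc n)) ^ Suc (Suc n))"
    by (intro real_sqrt_le_mono) (simp add: power2_eq_square mult.assoc)
  then show ?thesis by (simp add: half_power_def real_sqrt_mult)
qed

text \<open>Since \<open>(1 + n/m)\<^sup>m \<le> e\<^sup>n\<close>, one has \<open>(m + n)\<^sup>m \<le> m\<^sup>m e\<^sup>n\<close>; multiplying this by the inequality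
with \<open>m\<close> and \<open>n\<close> exchanged gives \<open>(m + n)\<^bsup>m+n\<^esup> \<le> e\<^bsup>m+n\<^esup> m\<^sup>m n\<^sup>n\<close>, and \<open>\<surd>e \<le> 2\<close>.\<close>

lemma half_power_add_le: "half_power (m + n) \<le> 2 ^ (m + n) * (half_power m * half_power n)"
proof -
  have one: "real (a + b) ^ a \<le> real a ^ a * exp 1 ^ b" for a b
  proof (cases "a = 0")
    case False
    have "(1 + real b / real a) ^ a \<le> exp (real b)"
      using False by (intro exp_ge_one_plus_x_over_n_power_n) auto
    also have "exp (real b) = exp 1 ^ b" by (simp flip: exp_of_nat_mult)
    finally have "real a ^ a * (1 + real b / real a) ^ a \<le> real a ^ a * exp 1 ^ b"
      by (intro mult_left_mono) auto
    also have "real a ^ a * (1 + real b / real a) ^ a = real (a + b) ^ a"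
      using False by (subst power_mult_distrib [symmetric]) (simp add: distrib_left)
    finally show ?thesis .
  qed simp
  have "real (m + n) ^ (m + n) \<le> (real m ^ m * exp 1 ^ n) * (real n ^ n * exp 1 ^ m)"
    unfolding power_add using one [of m n] one [of n m]
    by (intro mult_mono) (auto simp: add.commute)
  also have "\<dots> = (exp 1) ^ (m + n) * (real m ^ m * real n ^ n)"
    by (simp add: power_add algebra_simps)
  also have "\<dots> \<le> (2\<^sup>2) ^ (m + n) * (real m ^ m * real n ^ n)"
    using exp_le by (intro mult_right_mono power_mono) auto
  also have "(2\<^sup>2 :: real) ^ (m + n) = (2 ^ (m + n))\<^sup>2"
    by (simp only: power_mult [symmetric] mult.commute)
  finally have "sqrt (real (m + n) ^ (m + n)) \<le> sqrt ((2 ^ (m + n))\<^sup>2 * (real m ^ m * real n ^ n))"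
    by (rule real_sqrt_le_mono)
  then show ?thesis by (simp add: half_power_def real_sqrt_mult)
qed

text \<open>The derivatives of \<open>exp(-t\<^sup>2/2)\<close>, through the three-term recursion of the Hermite polynomials.\<close>

fun gauss_deriv :: "nat \<Rightarrow> real \<Rightarrow> real" where
  "gauss_deriv 0 t = exp (- (t\<^sup>2 / 2))"
| "gauss_deriv (Suc 0) t = - t * exp (- (t\<^sup>2 / 2))"
| "gauss_deriv (Suc (Suc n)) t = - t * gauss_deriv (Suc n) t - real (Suc n) * gauss_deriv n t"

lemma gauss_deriv_has_derivative:
  "(gauss_deriv n has_field_derivative gauss_deriv (Suc n) t) (at t)"
proof (induction n t rule: gauss_deriv.induct)
  case (1 t)
  show ?case by (auto intro!: derivative_eq_intros)
next
  case (2 t)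
  show ?case by (auto intro!: derivative_eq_intros simp: algebra_simps power2_eq_square)
next
  case (3 n t)
  have "((\<lambda>t. - t * gauss_deriv (Suc n) t - real (Suc n) * gauss_deriv n t) has_field_derivative
      gauss_deriv (Suc (Suc (Suc n))) t) (at t)"
    by (rule derivative_eq_intros 3 refl)+ (simp add: algebra_simps)
  also have "(\<lambda>t. - t * gauss_deriv (Suc n) t - real (Suc n) * gauss_deriv n t) =
      gauss_deriv (Suc (Suc n))"
    by (rule ext) simp
  finally show ?case .
qed

text \<open>At the origin the recursion reads \<open>G\<^sub>n\<^sub>+\<^sub>2(0) = -(n + 1) G\<^sub>n(0)\<close>, so two differentiations turn the
phase by \<open>i\<^sup>2\<close>.\<close>

lemma gauss_deriv_at_0:
  "\<exists>g\<ge>0. complex_of_real (gauss_deriv n 0) = \<i> ^ n * complex_of_real g"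
proof (induction n "0::real" rule: gauss_deriv.induct)
  case (3 n)
  then obtain g where "g \<ge> 0" "complex_of_real (gauss_deriv n 0) = \<i> ^ n * complex_of_real g" by blast
  then show ?case by (intro exI [of _ "real (Suc n) * g"]) (simp)
qed (auto intro: exI [of _ 1])

text \<open>From \<open>t\<^sup>2/n \<le> exp(t\<^sup>2/n)\<close>, by raising to the power \<open>n/2\<close>.\<close>

lemma power_gauss_le: "\<bar>t\<bar> ^ n * exp (- (t\<^sup>2 / 2)) \<le> half_power n"
proof (cases "n = 0")
  case False
  have "t\<^sup>2 / real n \<le> exp (t\<^sup>2 / real n)"
    using exp_ge_add_one_self [of "t\<^sup>2 / real n"] by linarith
  then have "(t\<^sup>2 / real n) ^ n \<le> exp (t\<^sup>2 / real n) ^ n" by (intro power_mono) auto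
  also have "\<dots> = exp (t\<^sup>2)" using False by (simp flip: exp_of_nat_mult)
  finally have "(\<bar>t\<bar> ^ n)\<^sup>2 \<le> real n ^ n * exp (t\<^sup>2)"
    using False by (simp add: power_divide field_simps power2_abs flip: power_mult)
       (simp add: power_even_abs)
  then have "sqrt ((\<bar>t\<bar> ^ n)\<^sup>2) \<le> sqrt (real n ^ n * (exp (t\<^sup>2 / 2))\<^sup>2)"
    by (intro real_sqrt_le_mono) (simp flip: exp_double)
  then have "\<bar>t\<bar> ^ n \<le> half_power n * exp (t\<^sup>2 / 2)"
    by (simp add: real_sqrt_mult half_power_def)
  then show ?thesis by (simp add: exp_minus field_simps)
qed (simp add: half_power_def)

text \<open>By the recursion, the bounds \<open>2\<^sup>n A\<^sub>a\<^sub>+\<^sub>n\<close> are inherited as soon as \<open>(n + 1) A\<^sub>a\<^sub>+\<^sub>n \<le> A\<^sub>a\<^sub>+\<^sub>n\<^sub>+\<^sub>2\<close>,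
which \<^const>\<open>half_power\<close> satisfies. Keeping the power \<open>a\<close> of \<open>t\<close> general is essential, because the
factor \<open>t\<close> in the recursion raises it.\<close>

lemma power_gauss_deriv_le: "\<bar>t\<bar> ^ a * \<bar>gauss_deriv n t\<bar> \<le> 2 ^ n * half_power (a + n)"
proof (induction n arbitrary: a rule: induct_nat_012)
  case 0
  then show ?case using power_gauss_le by simp
next
  case 1
  have "\<bar>t\<bar> ^ a * \<bar>gauss_deriv 1 t\<bar> \<le> half_power (a + 1)"
    using power_gauss_le [of t "a + 1"] by (simp add: abs_mult ac_simps)
  also have "\<dots> \<le> 2 ^ 1 * half_power (a + 1)" by simp
  finally show ?case by simp
next
  case (ge2 n)
  have "\<bar>t\<bar> ^ a * \<bar>gauss_deriv (Suc (Suc n)) t\<bar> \<le>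
      \<bar>t\<bar> ^ a * (\<bar>t\<bar> * \<bar>gauss_deriv (Suc n) t\<bar> + real (Suc n) * \<bar>gauss_deriv n t\<bar>)"
    using abs_triangle_ineq4 [of "- t * gauss_deriv (Suc n) t" "real (Suc n) * gauss_deriv n t"]
    by (intro mult_left_mono) (auto simp: abs_mult)
  also have "\<dots> = \<bar>t\<bar> ^ (a + 1) * \<bar>gauss_deriv (Suc n) t\<bar> + real (Suc n) * (\<bar>t\<bar> ^ a * \<bar>gauss_deriv n t\<bar>)"
    by (simp add: algebra_simps)
  also have "\<dots> \<le> 2 ^ Suc n * half_power (a + 1 + Suc n) + real (Suc n) * (2 ^ n * half_power (a + n))"
    by (intro add_mono mult_left_mono ge2) auto
  also have "real (Suc n) * (2 ^ n * half_power (a + n)) \<le> 2 ^ Suc n * (real (Suc (a + n)) * half_power (a + n))"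
    using half_power_nonneg [of "a + n"]
    by (simp add: mult.assoc [symmetric] del: half_power_nonneg) (intro mult_right_mono, auto simp: algebra_simps)
  also have "\<dots> \<le> 2 ^ Suc n * half_power (Suc (Suc (a + n)))"
    by (intro mult_left_mono half_power_Suc_Suc) auto
  finally show ?case by simp
qed

corollary power_gauss_deriv_le_separated:
  "\<bar>t\<bar> ^ a * \<bar>gauss_deriv n t\<bar> \<le> 4 ^ (a + n) * (half_power a * half_power n)"
proof -
  have "\<bar>t\<bar> ^ a * \<bar>gauss_deriv n t\<bar> \<le> 2 ^ n * half_power (a + n)"
    by (rule power_gauss_deriv_le)
  also have "\<dots> \<le> 2 ^ (a + n) * (2 ^ (a + n) * (half_power a * half_power n))"
    by (intro mult_mono half_power_add_le power_increasing) auto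
  also have "\<dots> = 4 ^ (a + n) * (half_power a * half_power n)"
    by (simp add: mult.assoc [symmetric] flip: power_mult_distrib)
  finally show ?thesis .
qed

section \<open>A test function with extremal derivatives\<close>

locale log_convex_sequence =
  fixes M :: "nat \<Rightarrow> real"
  assumes pos: "0 < M p"
    and log_convex: "(M (Suc p))\<^sup>2 \<le> M p * M (Suc (Suc p))"
begin

definition quot :: "nat \<Rightarrow> real" where
  "quot k = M (Suc k) / M k"

lemma quot_pos: "0 < quot k"
  using pos by (simp add: quot_def)

lemma M_Suc: "M (Suc k) = M k * quot k"
  using pos [of k] by (simp add: quot_def)

lemma incseq_quot: "incseq quot"
  using log_convex pos by (intro incseq_SucI) (simp add: quot_def field_simps power2_eq_square)

text \<open>A convex function lies above its tangents: on the logarithmic scale \<open>log (quot k)\<close> is the slope of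
the sequence to the right of \<open>k\<close>. The inequality \<open>M\<^sub>k \<mu>\<^sub>k\<^bsup>p-k\<^esup> \<le> M\<^sub>p\<close> is multiplied out to avoid
negative exponents.\<close>

lemma above_tangent: "M k * quot k ^ p \<le> M p * quot k ^ k"
proof (cases "k \<le> p")
  case True
  have "M k * quot k ^ n \<le> M (k + n)" for n
  proof (induction n)
    case (Suc n)
    have "M k * quot k ^ Suc n = (M k * quot k ^ n) * quot k" by simp
    also have "\<dots> \<le> M (k + n) * quot (k + n)"
      using Suc incseq_quot pos [of "k + n"] quot_pos [of k]
      by (intro mult_mono) (auto simp: incseq_def less_imp_le)
    finally show ?case by (simp add: M_Suc)
  qed simp
  from this [of "p - k"] True quot_pos [of k]
  have "M k * quot k ^ (p - k) * quot k ^ k \<le> M p * quot k ^ k"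
    by (intro mult_right_mono) (auto simp: less_imp_le)
  with True show ?thesis by (simp add: mult.assoc flip: power_add)
next
  case False
  have "M (p + n) \<le> M p * Q ^ n" if "quot (p + n) \<le> Q" for n Q
    using that
  proof (induction n)
    case (Suc n)
    have le: "quot (p + n) \<le> Q"
      using incseq_SucD [OF incseq_quot, of "p + n"] Suc.prems by simp
    have "M (p + Suc n) = M (p + n) * quot (p + n)" by (simp add: M_Suc)
    also have "\<dots> \<le> (M p * Q ^ n) * Q"
      using Suc.IH le pos [of p] quot_pos [of "p + n"]
      by (intro mult_mono) (auto simp: less_imp_le)
    finally show ?case by (simp add: algebra_simps)
  qed simp
  from this [of "k - p" "quot k"] False quot_pos [of k]
  have "M k * quot k ^ p \<le> M p * quot k ^ (k - p) * quot k ^ p"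
    by (intro mult_right_mono) (auto simp: less_imp_le)
  with False show ?thesis by (simp add: mult.assoc flip: power_add)
qed

text \<open>The modulus of the \<open>k\<close>-th term of the \<open>q\<close>-th derivative of the exponential series. The factor \<open>2\<close> in the
frequency \<open>2\<mu>\<^sub>k\<close> yields the convergence factor \<open>2\<^bsup>-k\<^esup>\<close> in \<open>coeff_le\<close>, at the price of \<open>2\<^sup>q\<close>.\<close>

definition coeff :: "nat \<Rightarrow> nat \<Rightarrow> real" where
  "coeff q k = M k / (2 * quot k) ^ k * (2 * quot k) ^ q"

lemma coeff_pos: "0 < coeff q k"
  using pos quot_pos by (simp add: coeff_def)

lemma coeff_diagonal: "coeff q q = M q"
  using quot_pos [of q] by (simp add: coeff_def)

lemma coeff_Suc: "coeff (Suc q) k = coeff q k * (2 * quot k)"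
  by (simp add: coeff_def)

lemma coeff_le: "coeff q k \<le> 2 ^ q * M q * (1 / 2) ^ k"
  using above_tangent [of k q] quot_pos [of k]
  by (simp add: coeff_def power_mult_distrib field_simps)

lemma sums_coeff_bound: "(\<lambda>k. 2 ^ q * M q * (1 / 2) ^ k) sums (2 ^ Suc q * M q)"
  using sums_mult [OF geometric_sums [of "1 / 2 :: real"], of "2 ^ q * M q"]
  by (simp add: algebra_simps)

lemma summable_coeff: "summable (coeff q)"
  using coeff_le coeff_pos
  by (intro summable_comparison_test' [OF sums_summable [OF sums_coeff_bound], of 0])
    (auto simp: abs_of_pos)

lemma suminf_coeff_le: "suminf (coeff q) \<le> 2 ^ Suc q * M q"
  using suminf_le [OF coeff_le summable_coeff sums_summable [OF sums_coeff_bound]] sums_coeff_bound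
  by (simp add: sums_iff)

lemma suminf_coeff_ge: "M q \<le> suminf (coeff q)"
  using sum_le_suminf [OF summable_coeff, of "{q}" q] coeff_pos
  by (simp add: coeff_diagonal less_imp_le)

text \<open>The \<open>q\<close>-th derivative of the \<open>k\<close>-th term of the exponential series.\<close>

definition wave :: "nat \<Rightarrow> nat \<Rightarrow> real \<Rightarrow> complex" where
  "wave q k t = \<i> ^ q * complex_of_real (coeff q k) * exp (\<i> * complex_of_real (2 * quot k * t))"

lemma norm_wave [simp]: "norm (wave q k t) = coeff q k"
  using coeff_pos [of q k] by (simp add: wave_def norm_mult norm_power)

lemma wave_has_derivative: "(wave q k has_vector_derivative wave (Suc q) k t) (at t)"
  unfolding wave_def coeff_Suc of_real_mult
  by (rule has_vector_derivative_real_field) (auto intro!: derivative_eq_intros)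

definition series :: "nat \<Rightarrow> real \<Rightarrow> complex" where
  "series q t = (\<Sum>k. wave q k t)"

lemma series_has_derivative: "(series q has_vector_derivative series (Suc q) t) (at t)"
  unfolding series_def
  by (rule has_vector_derivative_suminf [where a = "coeff q" and b = "coeff (Suc q)"])
    (auto intro: wave_has_derivative summable_coeff)

lemma norm_series_le: "norm (series q t) \<le> 2 ^ Suc q * M q"
proof -
  have "norm (series q t) \<le> (\<Sum>k. norm (wave q k t))"
    unfolding series_def by (intro summable_norm) (simp add: summable_coeff)
  with suminf_coeff_le show ?thesis by (simp, meson order_trans)
qed

lemma series_at_0: "series q 0 = \<i> ^ q * complex_of_real (suminf (coeff q))"
proof -
  have "(\<lambda>k. complex_of_real (coeff q k)) sums complex_of_real (suminf (coeff q))"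
    by (intro sums_of_real summable_sums summable_coeff)
  from sums_mult [OF this, of "\<i> ^ q"] show ?thesis
    by (simp add: series_def wave_def sums_iff)
qed

text \<open>The \<open>p\<close>-th derivative of the product of the exponential series and the Gaussian, by the Leibniz formula.\<close>

definition test_deriv :: "nat \<Rightarrow> real \<Rightarrow> complex" where
  "test_deriv p t =
    (\<Sum>j\<le>p. of_nat (p choose j) * series (p - j) t * complex_of_real (gauss_deriv j t))"

lemma test_deriv_has_derivative:
  "(test_deriv p has_vector_derivative test_deriv (Suc p) t) (at t)"
  unfolding test_deriv_def
  by (rule has_vector_derivative_Leibniz_sum)
    (auto intro: series_has_derivative has_vector_derivative_of_real
      gauss_deriv_has_derivative)

text \<open>At the origin the \<open>j\<close>-th summand of the Leibniz formula is \<open>i\<^bsup>p-j\<^esup> i\<^sup>j = i\<^sup>p\<close> times a nonnegative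
number. All summands have the same phase, and the modulus is at least that of the summand \<open>j = 0\<close>.\<close>

lemma norm_test_deriv_at_0_ge: "M p \<le> norm (test_deriv p 0)"
proof -
  obtain g where g: "\<And>j. 0 \<le> g j" "\<And>j. complex_of_real (gauss_deriv j 0) = \<i> ^ j * complex_of_real (g j)"
    using gauss_deriv_at_0 by metis
  have g0: "g 0 = 1" using g(2) [of 0] by simp
  define s where "s j = of_nat (p choose j) * suminf (coeff (p - j)) * g j" for j
  have s: "0 \<le> s j" for j
    using g(1) [of j] suminf_coeff_ge [of "p - j"] pos [of "p - j"] by (simp add: s_def)
  have "test_deriv p 0 = (\<Sum>j\<le>p. \<i> ^ p * complex_of_real (s j))"
    unfolding test_deriv_def
  proof (rule sum.cong [OF refl])
    fix j assume j: "j \<in> {..p}"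
    have "of_nat (p choose j) * series (p - j) 0 * complex_of_real (gauss_deriv j 0)
        = (\<i> ^ (p - j) * \<i> ^ j) * complex_of_real (s j)"
      by (simp add: series_at_0 g(2) s_def)
    also have "\<i> ^ (p - j) * \<i> ^ j = \<i> ^ p"
      using j by (simp flip: power_add)
    finally show "of_nat (p choose j) * series (p - j) 0 * complex_of_real (gauss_deriv j 0)
        = \<i> ^ p * complex_of_real (s j)" .
  qed
  also have "\<dots> = \<i> ^ p * complex_of_real (\<Sum>j\<le>p. s j)"
    by (simp add: sum_distrib_left)
  finally have "norm (test_deriv p 0) = (\<Sum>j\<le>p. s j)"
    using s by (simp add: norm_mult norm_power sum_nonneg flip: of_real_sum)
  moreover have "s 0 \<le> (\<Sum>j\<le>p. s j)"
    using s by (intro member_le_sum) auto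
  moreover have "M p \<le> s 0"
    using suminf_coeff_ge [of p] by (simp add: s_def g0)
  ultimately show ?thesis by linarith
qed

text \<open>The derivatives of the Gaussian contribute \<open>j\<^bsup>j/2\<^esup>\<close> next to the bound \<open>M\<^sub>p\<^sub>-\<^sub>j\<close> for the series, and the
assumption, which is (R1) in dimension one, converts their product into \<open>K\<^sub>p\<close>. What remains is a
binomial sum. The factor \<open>half_power a\<close> is kept, because joint and separated growth dispose of it
in different ways.\<close>

lemma norm_power_test_deriv_le:
  assumes K: "\<And>i j. half_power i * M j \<le> B * C ^ i * H ^ (i + j) * K (i + j)"
    and BCH: "0 < B" "0 < C" "0 < H"
  shows "\<bar>t\<bar> ^ a * norm (test_deriv p t) \<le> 2 * B * 4 ^ a * half_power a * (H * (2 + 4 * C)) ^ p * K p"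
proof -
  have "\<bar>t\<bar> ^ a * norm (test_deriv p t) \<le>
      \<bar>t\<bar> ^ a * (\<Sum>j\<le>p. of_nat (p choose j) * norm (series (p - j) t) * \<bar>gauss_deriv j t\<bar>)"
    unfolding test_deriv_def
    by (intro mult_left_mono order_trans [OF norm_sum] sum_mono) (auto simp: norm_mult)
  also have "\<dots> = (\<Sum>j\<le>p. of_nat (p choose j) * norm (series (p - j) t) * (\<bar>t\<bar> ^ a * \<bar>gauss_deriv j t\<bar>))"
    by (simp add: sum_distrib_left algebra_simps)
  also have "\<dots> \<le> (\<Sum>j\<le>p. of_nat (p choose j) * (2 ^ Suc (p - j) * M (p - j)) *
      (4 ^ (a + j) * (half_power a * half_power j)))"
    using pos by (intro sum_mono mult_mono power_gauss_deriv_le_separated norm_series_le order_refl)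
      (auto intro: mult_nonneg_nonneg less_imp_le)
  also have "\<dots> = (\<Sum>j\<le>p. 2 * 4 ^ a * half_power a * (of_nat (p choose j) * 2 ^ (p - j) * 4 ^ j) *
      (half_power j * M (p - j)))"
    by (simp add: algebra_simps power_add)
  also have "\<dots> \<le> (\<Sum>j\<le>p. 2 * 4 ^ a * half_power a * (of_nat (p choose j) * 2 ^ (p - j) * 4 ^ j) *
      (B * C ^ j * H ^ p * K p))"
  proof (intro sum_mono mult_left_mono)
    show "half_power j * M (p - j) \<le> B * C ^ j * H ^ p * K p" if "j \<in> {..p}" for j
      using K [of j "p - j"] that by simp
  qed simp
  also have "\<dots> = 2 * B * 4 ^ a * half_power a * H ^ p * K p *
      (\<Sum>j\<le>p. of_nat (p choose j) * (4 * C) ^ j * 2 ^ (p - j))"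
    by (simp add: sum_distrib_left algebra_simps)
  also have "(\<Sum>j\<le>p. of_nat (p choose j) * (4 * C) ^ j * 2 ^ (p - j)) = (4 * C + 2) ^ p"
    by (rule binomial_ring [symmetric])
  finally show ?thesis by (simp only: power_mult_distrib ac_simps)
qed

end

section \<open>Extremal functions in the one-dimensional Roumieu class\<close>

text \<open>If the index type has a single element \<open>i0\<close>, then \<open>x \<mapsto> x $ i0\<close> identifies \<open>\<real>\<^sup>1\<close> with \<open>\<real>\<close> and multi-indices
with natural numbers.\<close>

context
  fixes i0 :: "'n::finite"
  assumes UNIV_i0: "(UNIV :: 'n set) = {i0}"
begin

lemma eq_i0: "i = i0"
  using UNIV_i0 by blast

lemma mi_size_single: "mi_size (\<alpha> :: nat ^ 'n) = \<alpha> $ i0"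
  by (simp add: mi_size_def UNIV_i0)

lemma mi_monom_single: "mi_monom x (\<alpha> :: nat ^ 'n) = (x $ i0) ^ (\<alpha> $ i0)"
  by (simp add: mi_monom_def UNIV_i0)

lemma mi_half_power_single: "mi_half_power (\<alpha> :: nat ^ 'n) = half_power (\<alpha> $ i0)"
  by (simp add: mi_half_power_def half_power_def UNIV_i0)

lemma vec_single: "(\<chi> i. \<alpha> $ i0) = (\<alpha> :: nat ^ 'n)"
  by (simp add: vec_eq_iff) (metis eq_i0)

text \<open>A sequence of functions on \<open>\<real>\<close>, each the derivative of its predecessor, gives a smooth function on
\<open>\<real>\<^sup>1\<close> together with all its partial derivatives. The length of the list of directions alone decides
which derivative is taken.\<close>

lemma
  fixes F :: "nat \<Rightarrow> real \<Rightarrow> complex"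
  assumes F: "\<And>p t. (F p has_vector_derivative F (Suc p) t) (at t)"
  shows iter_partial_single: "iter_partial is (\<lambda>x :: real ^ 'n. F 0 (x $ i0)) = (\<lambda>x. F (length is) (x $ i0))"
    and C_infinity_single: "(\<lambda>x :: real ^ 'n. F 0 (x $ i0)) \<in> C_infinity"
    and mi_deriv_single: "mi_deriv \<beta> (\<lambda>x :: real ^ 'n. F 0 (x $ i0)) x = F (\<beta> $ i0) (x $ i0)"
proof -
  have shift: "((\<lambda>t. F p ((x + t *\<^sub>R axis i 1) $ i0)) has_vector_derivative F (Suc p) (x $ i0)) (at 0)"
    for p i and x :: "real ^ 'n"
  proof -
    have "((\<lambda>t. x $ i0 + t) has_vector_derivative 1) (at 0)"
      by (auto intro!: derivative_eq_intros)
    from vector_diff_chain_at [OF this, of "F p" "F (Suc p) (x $ i0)"] F [of p "x $ i0"]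
    have "((\<lambda>t. F p (x $ i0 + t)) has_vector_derivative F (Suc p) (x $ i0)) (at 0)"
      by (simp add: o_def)
    then show ?thesis by (simp add: axis_def eq_i0 [of i])
  qed
  show iter: "iter_partial is (\<lambda>x :: real ^ 'n. F 0 (x $ i0)) = (\<lambda>x. F (length is) (x $ i0))" for "is"
  proof (induction "is")
    case (Cons i "is")
    then show ?case
      using vector_derivative_at [OF shift] by (simp only: iter_partial.simps partial_deriv_def length_Cons)
  qed simp
  have "continuous_on UNIV (F p)" for p
    using F has_vector_derivative_continuous by (blast intro: continuous_at_imp_continuous_on)
  then have "continuous_on UNIV (\<lambda>x :: real ^ 'n. F p (x $ i0))" for p
    by (rule continuous_on_compose2) (auto intro!: continuous_intros)
  then show "(\<lambda>x :: real ^ 'n. F 0 (x $ i0)) \<in> C_infinity"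
    unfolding C_infinity_def mem_Collect_eq iter has_partial_deriv_at_def
    using differentiableI_vector [OF shift] by blast
  have count: "count_list is i = length is" for "is" and i :: 'n
  proof (induction "is")
    case (Cons j "is")
    then show ?case using eq_i0 [of i] eq_i0 [of j] by simp
  qed simp
  have "\<forall>i. count_list (replicate (\<beta> $ i0) i0) i = \<beta> $ i"
    unfolding count by (metis length_replicate eq_i0)
  then have "\<forall>i. count_list (SOME is. \<forall>i. count_list is i = \<beta> $ i) i = \<beta> $ i"
    by (rule someI)
  then have "length (SOME is. \<forall>i. count_list is i = \<beta> $ i) = \<beta> $ i0"
    unfolding count by blast
  then show "mi_deriv \<beta> (\<lambda>x :: real ^ 'n. F 0 (x $ i0)) x = F (\<beta> $ i0) (x $ i0)"
    by (simp add: mi_deriv_def iter)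
qed

lemma cond_R1_half_power:
  fixes M :: "real \<Rightarrow> nat ^ 'n \<Rightarrow> real"
  assumes "cond_R1 M" "0 < l"
  obtains k B C H where "0 < k" "0 < B" "0 < C" "0 < H"
    "\<And>\<alpha> \<beta>. half_power (\<alpha> $ i0) * M l \<beta> \<le> B * C ^ (\<alpha> $ i0) * H ^ (\<alpha> $ i0 + \<beta> $ i0) * M k (\<alpha> + \<beta>)"
proof -
  obtain k B C H where "l \<le> k" "0 < B" "0 < C" "0 < H"
    "\<And>\<alpha> \<beta>. mi_half_power \<alpha> * M l \<beta> \<le> B * C ^ mi_size \<alpha> * H ^ mi_size (\<alpha> + \<beta>) * M k (\<alpha> + \<beta>)"
    using assms unfolding cond_R1_def by blast
  with \<open>0 < l\<close> show thesis
    by (intro that [of k B C H]) (simp_all add: mi_half_power_single mi_size_single)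
qed

text \<open>The test function for the sequence \<open>M\<^bsup>(\<lambda>)\<^esup>\<close> satisfies
\<open>|x\<^sup>\<alpha> f\<^bsup>(\<beta>)\<^esup>(x)| \<le> K c\<^bsup>\<alpha>+\<beta>\<^esup> \<alpha>\<^bsup>\<alpha>/2\<^esup> M\<^sub>\<beta>\<^bsup>(\<kappa>)\<^esup>\<close> after one use of (R1). A second use of (R1) finishes both
cases: applied to \<open>\<alpha>\<close> and \<open>\<beta>\<close> it merges \<open>\<alpha>\<^bsup>\<alpha>/2\<^esup> M\<^sub>\<beta>\<^bsup>(\<kappa>)\<^esup>\<close> into a single weight at \<open>\<alpha> + \<beta>\<close>; applied to \<open>\<alpha>\<close>
and \<open>0\<close> it replaces \<open>\<alpha>\<^bsup>\<alpha>/2\<^esup>\<close> by a weight at \<open>\<alpha>\<close>.\<close>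

lemma extremal_function:
  fixes M :: "real \<Rightarrow> nat ^ 'n \<Rightarrow> real"
  assumes M: "weight_matrix M" and lc: "standard_log_convex M" and R1: "cond_R1 M" and l: "0 < l"
  obtains f where "f \<in> gs_roumieu joint_growth M" "f \<in> gs_roumieu separated_growth M"
    "\<And>\<beta>. M l \<beta> \<le> norm (mi_deriv \<beta> f 0)"
proof -
  define m where "m p = M l (\<chi> i. p)" for p
  have Mpos: "0 < M k \<alpha>" if "0 < k" for k \<alpha>
    using M that by (simp add: weight_matrix_def)
  interpret log_convex_sequence m
  proof
    have m: "m \<in> log_convex_class"
      using lc l unfolding standard_log_convex_def m_def by blast
    then show "0 < m p" for p by (simp add: log_convex_class_def)
    have "\<forall>p\<ge>1. (m p)\<^sup>2 \<le> m (p - 1) * m (p + 1)"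
      using m by (simp add: log_convex_class_def)
    from this [rule_format, of "Suc p" for p] show "(m (Suc p))\<^sup>2 \<le> m p * m (Suc (Suc p))" for p
      by simp
  qed
  have m_eq: "m (\<alpha> $ i0) = M l \<alpha>" for \<alpha>
    by (simp add: m_def vec_single)
  define f where "f x = test_deriv 0 (x $ i0)" for x :: "real ^ 'n"
  have f: "f \<in> C_infinity" "mi_deriv \<beta> f x = test_deriv (\<beta> $ i0) (x $ i0)" for \<beta> x
    unfolding f_def using C_infinity_single [where F = test_deriv, OF test_deriv_has_derivative]
      mi_deriv_single [where F = test_deriv, OF test_deriv_has_derivative] by blast+
  obtain k B C H where pos: "0 < k" "0 < B" "0 < C" "0 < H" and
    k: "\<And>\<alpha> \<beta>. half_power (\<alpha> $ i0) * M l \<beta> \<le> B * C ^ (\<alpha> $ i0) * H ^ (\<alpha> $ i0 + \<beta> $ i0) * M k (\<alpha> + \<beta>)"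
    using cond_R1_half_power [OF R1 l] by blast
  obtain k' B' C' H' where pos': "0 < k'" "0 < B'" "0 < C'" "0 < H'" and
    k': "\<And>\<alpha> \<beta>. half_power (\<alpha> $ i0) * M k \<beta> \<le> B' * C' ^ (\<alpha> $ i0) * H' ^ (\<alpha> $ i0 + \<beta> $ i0) * M k' (\<alpha> + \<beta>)"
    using cond_R1_half_power [OF R1 pos(1)] by blast
  have "half_power a * m b \<le> B * C ^ a * H ^ (a + b) * M k (\<chi> i. a + b)" for a b
    using k [of "\<chi> i. a" "\<chi> i. b"] by (simp add: m_def plus_vec_def)
  note bound = norm_power_test_deriv_le [where K = "\<lambda>p. M k (\<chi> i. p)", OF this pos(2-4)]
  have decay: "norm (complex_of_real (mi_monom x \<alpha>) * mi_deriv \<beta> f x) \<le>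
      2 * B * 4 ^ (\<alpha> $ i0) * (H * (2 + 4 * C)) ^ (\<beta> $ i0) * (half_power (\<alpha> $ i0) * M k \<beta>)" for \<alpha> \<beta> x
    using bound [of "x $ i0" "\<alpha> $ i0" "\<beta> $ i0"]
    by (simp add: f(2) mi_monom_single norm_mult norm_power vec_single mult_ac)
  show thesis
  proof
    show "f \<in> gs_roumieu joint_growth M"
    proof (rule gs_roumieuI [OF f(1)])
      fix \<alpha> \<beta> x
      note decay [of x \<alpha> \<beta>]
      also have "2 * B * 4 ^ (\<alpha> $ i0) * (H * (2 + 4 * C)) ^ (\<beta> $ i0) * (half_power (\<alpha> $ i0) * M k \<beta>) \<le>
          2 * B * 4 ^ (\<alpha> $ i0) * (H * (2 + 4 * C)) ^ (\<beta> $ i0) *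
          (B' * C' ^ (\<alpha> $ i0) * H' ^ (\<alpha> $ i0 + \<beta> $ i0) * M k' (\<alpha> + \<beta>))"
        using pos by (intro mult_left_mono k') auto
      also have "\<dots> = 2 * B * B' * ((4 * C' * H') ^ mi_size \<alpha> * (H * (2 + 4 * C) * H') ^ mi_size \<beta> *
          joint_growth (M k') \<alpha> \<beta>)"
        by (simp only: power_mult_distrib power_add mult_ac mi_size_single joint_growth_def)
      finally show "cmod (complex_of_real (mi_monom x \<alpha>) * mi_deriv \<beta> f x) \<le> \<dots>" .
    qed (use pos pos' Mpos in \<open>auto simp: joint_growth_def\<close>)
  next
    \<comment> \<open>separated growth needs one parameter for both weights\<close>
    define K where "K = max k k'"
    have "0 < K" using pos(1) by (simp add: K_def)
    have M_K: "M k \<alpha> \<le> M K \<alpha>" "M k' \<alpha> \<le> M K \<alpha>" for \<alpha>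
      using M pos(1) pos'(1) unfolding weight_matrix_def K_def by (metis max.cobounded1 max.cobounded2)+
    have "M k 0 = 1" using M pos(1) by (simp add: weight_matrix_def)
    with k' [of _ 0] have half_le: "half_power (\<alpha> $ i0) \<le> B' * C' ^ (\<alpha> $ i0) * H' ^ (\<alpha> $ i0) * M k' \<alpha>" for \<alpha>
      by simp
    show "f \<in> gs_roumieu separated_growth M"
    proof (rule gs_roumieuI [OF f(1)])
      fix \<alpha> \<beta> x
      note decay [of x \<alpha> \<beta>]
      also have "2 * B * 4 ^ (\<alpha> $ i0) * (H * (2 + 4 * C)) ^ (\<beta> $ i0) * (half_power (\<alpha> $ i0) * M k \<beta>) \<le>
          2 * B * 4 ^ (\<alpha> $ i0) * (H * (2 + 4 * C)) ^ (\<beta> $ i0) *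
          ((B' * C' ^ (\<alpha> $ i0) * H' ^ (\<alpha> $ i0) * M K \<alpha>) * M K \<beta>)"
      proof (intro mult_left_mono mult_mono M_K)
        have "B' * C' ^ (\<alpha> $ i0) * H' ^ (\<alpha> $ i0) * M k' \<alpha> \<le> B' * C' ^ (\<alpha> $ i0) * H' ^ (\<alpha> $ i0) * M K \<alpha>"
          using pos' by (intro mult_left_mono M_K) auto
        with half_le show "half_power (\<alpha> $ i0) \<le> B' * C' ^ (\<alpha> $ i0) * H' ^ (\<alpha> $ i0) * M K \<alpha>"
          by (rule order_trans)
      qed (use pos pos' Mpos \<open>0 < K\<close> in \<open>auto simp: less_imp_le\<close>)
      also have "\<dots> = 2 * B * B' * ((4 * C' * H') ^ mi_size \<alpha> * (H * (2 + 4 * C)) ^ mi_size \<beta> *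
          separated_growth (M K) \<alpha> \<beta>)"
        by (simp only: power_mult_distrib mult_ac mi_size_single separated_growth_def)
      finally show "cmod (complex_of_real (mi_monom x \<alpha>) * mi_deriv \<beta> f x) \<le> \<dots>" .
    qed (use pos pos' Mpos \<open>0 < K\<close> in \<open>auto simp: separated_growth_def\<close>)
  next
    show "M l \<beta> \<le> norm (mi_deriv \<beta> f 0)" for \<beta>
      using norm_test_deriv_at_0_ge [of "\<beta> $ i0"] by (simp add: f(2) m_eq)
  qed
qed

end

section \<open>From inclusions of classes to the order of matrices\<close>

text \<open>The norms of the Beurling class are tested at \<open>x = 0\<close> and \<open>\<alpha> = 0\<close> only, where joint and
separated growth agree because the sequences are normalised by \<open>N\<^sub>0 = 1\<close>.\<close>

lemma strictly_below_if_extremal_functions: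
  fixes M N :: "real \<Rightarrow> nat ^ 'n::finite \<Rightarrow> real"
  assumes M: "weight_matrix M" and N: "weight_matrix N"
    and G: "\<And>k \<alpha> \<beta>. 0 < k \<Longrightarrow> 0 < G (N k) \<alpha> \<beta>" "\<And>k \<beta>. 0 < k \<Longrightarrow> G (N k) 0 \<beta> = N k \<beta>"
    and sub: "gs_roumieu G M \<subseteq> gs_beurling G N"
    and extremal: "\<And>l. 0 < l \<Longrightarrow> \<exists>f\<in>gs_roumieu G M. \<forall>\<beta>. M l \<beta> \<le> norm (mi_deriv \<beta> f 0)"
  shows "matrix_strictly_below M N"
  unfolding matrix_strictly_below_def
proof (intro allI impI)
  fix l k :: real assume lk: "0 < l" "0 < k"
  have pos: "\<And>\<alpha>. 0 < M l \<alpha>" "\<And>\<alpha>. 0 < N k \<alpha>"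
    using M N lk by (auto simp: weight_matrix_def)
  obtain f where f: "f \<in> gs_beurling G N" "\<And>\<beta>. M l \<beta> \<le> norm (mi_deriv \<beta> f 0)"
    using extremal [OF lk(1)] sub by blast
  show "seq_strictly_below (M l) (N k)"
    unfolding seq_strictly_below_iff [of "M l" "N k", OF pos]
  proof (intro allI impI)
    fix q :: real assume q: "0 < q"
    then have "gs_norm (G (N k)) q f < \<infinity>"
      using f(1) lk(2) by (simp add: gs_beurling_def)
    then obtain C where C: "0 < C" "\<And>\<alpha> \<beta> x. cmod (complex_of_real (mi_monom x \<alpha>) * mi_deriv \<beta> f x) \<le>
        C * (q ^ mi_size (\<alpha> + \<beta>) * G (N k) \<alpha> \<beta>)"
      using gs_norm_finite_iff [of "G (N k)" q f] G(1) lk(2) q by blast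
    have "M l \<beta> \<le> C * q ^ mi_size \<beta> * N k \<beta>" for \<beta>
    proof -
      have "mi_monom (0 :: real ^ 'n) 0 = 1" by (simp add: mi_monom_def)
      then show ?thesis
        using C(2) [of 0 0 \<beta>] f(2) [of \<beta>] G(2) [OF lk(2)] by (simp add: mult.assoc)
    qed
    with C(1) show "\<exists>C>0. \<forall>\<beta>. M l \<beta> \<le> C * q ^ mi_size \<beta> * N k \<beta>" by blast
  qed
qed

theorem theorem4p5:
  fixes M N :: "real \<Rightarrow> nat ^ 'n::finite \<Rightarrow> real"
  assumes "weight_matrix M" and "weight_matrix N"
  shows
    "(matrix_strictly_below M N \<longrightarrow>
        continuously_included joint_growth M N \<and>
        continuously_included separated_growth M N) \<and>
     (CARD('n) = 1 \<and> standard_log_convex M \<and> standard_log_convex N \<and>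
      cond_R1 M \<and> cond_R2 M \<and> cond_B1 N \<and> cond_B2 N \<longrightarrow>
        (continuously_included joint_growth M N \<longrightarrow> matrix_strictly_below M N) \<and>
        (continuously_included separated_growth M N \<longrightarrow> matrix_strictly_below M N))"
proof (rule conjI, intro impI conjI; (elim conjE)?)
  show "continuously_included joint_growth M N" if "matrix_strictly_below M N"
    using assms that by (rule continuously_included_if_strictly_below)
  show "continuously_included separated_growth M N" if "matrix_strictly_below M N"
    using assms that by (rule continuously_included_if_strictly_below)
next
  show "CARD('n) = 1 \<and> standard_log_convex M \<and> standard_log_convex N \<and>
      cond_R1 M \<and> cond_R2 M \<and> cond_B1 N \<and> cond_B2 N \<longrightarrow>
        (continuously_included joint_growth M N \<longrightarrow> matrix_strictly_below M N) \<and>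
        (continuously_included separated_growth M N \<longrightarrow> matrix_strictly_below M N)"
  proof (rule impI, elim conjE)
    assume card: "CARD('n) = 1" and hyps: "standard_log_convex M" "cond_R1 M"
    from card obtain i0 :: 'n where i0: "UNIV = {i0}" by (rule card_1_singletonE)
    have pos: "\<And>k \<alpha>. 0 < k \<Longrightarrow> 0 < N k \<alpha>" "\<And>k. 0 < k \<Longrightarrow> N k 0 = 1"
      using assms(2) by (auto simp: weight_matrix_def)
    note below = strictly_below_if_extremal_functions [OF assms]
    note extremal = extremal_function [OF i0 assms(1) hyps]
    show "(continuously_included joint_growth M N \<longrightarrow> matrix_strictly_below M N) \<and>
        (continuously_included separated_growth M N \<longrightarrow> matrix_strictly_below M N)"
    proof (intro conjI impI)
      assume "continuously_included joint_growth M N"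
      then show "matrix_strictly_below M N"
        by (intro below [of joint_growth])
          (auto simp: continuously_included_def joint_growth_def pos intro: extremal)
    next
      assume "continuously_included separated_growth M N"
      then show "matrix_strictly_below M N"
        by (intro below [of separated_growth])
          (auto simp: continuously_included_def separated_growth_def pos intro: extremal)
    qed
  qed
qed

end
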